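(* Let $n>1$ be a natural number. Let $\zeta$ be the order type of $\mathscr{D}^{\|n\|}\cap[0,\delta(n))$ (as a well-ordered subset of $\mathbb{R}$; the superscript $\|n\|$ is read modulo $3$). Then $D(n)$ is equal to the smallest integer $k\ge 0$ such that $\zeta<\omega^k$.
   Context: Natural numbers are positive integers. The complexity $\|n\|$ of a natural number $n$ is the least number of $1$'s needed to write $n$ using any combination of addition and multiplication (with arbitrary parenthesization). The defect of $n$ is the real number $\delta(n)=\|n\|-3\log_3 n$. For $k\ge 1$, $E(k)$ is the largest natural number $n$ with $\|n\|\le k$. For a natural number $n$, $L(n)$ is the largest $k\ge 1$ such that $E(k)\le n$, and the integer defect of $n$ is $D(n)=\|n\|-L(n)$. For $a$ a congruence class modulo $3$, $\mathscr{D}^a=\{\delta(n): \|n\|\equiv a \pmod 3,\ n\neq 1\}$. It is known that each $\mathscr{D}^a$ is a well-ordered subset of $\mathbb{R}$ (of order type $\omega^\omega$), so the order types above are ordinals. Here $\omega^k$ is ordinal exponentiation, with $\omega^0=1$. *)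

theory Defs
  imports Complex_Main
begin

datatype expr = One | Add expr expr | Mul expr expr

primrec expr_val :: "expr \<Rightarrow> nat" where
  "expr_val One = 1"
| "expr_val (Add e f) = expr_val e + expr_val f"
| "expr_val (Mul e f) = expr_val e * expr_val f"

primrec ones_count :: "expr \<Rightarrow> nat" where
  "ones_count One = 1"
| "ones_count (Add e f) = ones_count e + ones_count f"
| "ones_count (Mul e f) = ones_count e + ones_count f"

(* Natural numbers are positive here; complexity 0 is a junk value and never used. *)
definition complexity :: "nat \<Rightarrow> nat" where
  "complexity n = (LEAST k. \<exists>e. expr_val e = n \<and> ones_count e = k)"

definition defect :: "nat \<Rightarrow> real" where
  "defect n = real (complexity n) - 3 * log 3 (real n)"

definition cpx_E :: "nat \<Rightarrow> nat" where
  "cpx_E k = (GREATEST n. n \<ge> 1 \<and> complexity n \<le> k)"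

definition cpx_L :: "nat \<Rightarrow> nat" where
  "cpx_L n = (GREATEST k. k \<ge> 1 \<and> cpx_E k \<le> n)"

definition integer_defect :: "nat \<Rightarrow> int" where
  "integer_defect n = int (complexity n) - int (cpx_L n)"

(* The congruence class modulo 3 is given by any representative a. *)
definition defects_mod3 :: "nat \<Rightarrow> real set" where
  "defects_mod3 a = {defect n | n. n \<ge> 1 \<and> complexity n mod 3 = a mod 3 \<and> n \<noteq> 1}"

(* An ordinal is represented by a well-order relation, and < on ordinals by ordLess, which includes
   the requirement that both relations are well-orders.
   The order omega_power k represents the ordinal power omega^k, by the recursion
   omega^0 = 1 and omega^(k+1) = omega^k * omega. The latter product consists of omega many
   consecutive copies of omega^k; the head of a list is the index of the copy. *)
primrec omega_power :: "nat \<Rightarrow> nat list rel" where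
  "omega_power 0 = {([], [])}"
| "omega_power (Suc k) =
     {(a # u, b # v) | a b u v. u \<in> Field (omega_power k) \<and> v \<in> Field (omega_power k) \<and>
        (a < b \<or> a = b \<and> (u, v) \<in> omega_power k)}"

lemma expr_val_pos: "expr_val e \<ge> 1"
  by (induction e) auto

lemma ones_count_pos: "ones_count e \<ge> 1"
  by (induction e) auto

lemma expr_exists: "n \<ge> 1 \<Longrightarrow> \<exists>e. expr_val e = n \<and> ones_count e = n"
proof (induction n rule: nat_induct_at_least)
  case base
  show ?case by (rule exI[of _ One]) simp
next
  case (Suc n)
  then obtain e where "expr_val e = n" "ones_count e = n" by blast
  then show ?case by (intro exI[of _ "Add e One"]) simp
qed

lemma complexity_attained:
  assumes "n \<ge> 1"
  shows "\<exists>e. expr_val e = n \<and> ones_count e = complexity n"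
  unfolding complexity_def using expr_exists[OF assms] by (rule LeastI)

lemma complexity_le: "n \<ge> 1 \<Longrightarrow> complexity n \<le> n"
  unfolding complexity_def using expr_exists by (rule Least_le)

lemma add_le_mult_if_ge_2: "2 \<le> a \<Longrightarrow> 2 \<le> b \<Longrightarrow> a + b \<le> a * b" for a b :: nat
proof -
  assume "2 \<le> a" "2 \<le> b"
  then obtain c d where "a = 2 + c" "b = 2 + d" by (metis le_Suc_ex)
  then show ?thesis by (simp add: algebra_simps)
qed

lemma expr_val_le: "expr_val e \<le> 2 ^ ones_count e"
proof (induction e)
  case (Add e f)
  have "(2::nat) \<le> 2 ^ ones_count e" "(2::nat) \<le> 2 ^ ones_count f"
    using ones_count_pos power_increasing[of 1 _ "2::nat"] by auto
  then have "(2::nat) ^ ones_count e + 2 ^ ones_count f \<le> 2 ^ ones_count e * 2 ^ ones_count f"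
    by (rule add_le_mult_if_ge_2)
  with Add show ?case by (simp add: power_add)
qed (auto simp: power_add intro: mult_le_mono)

lemma le_of_complexity_le:
  assumes "n \<ge> 1" "complexity n \<le> k"
  shows "n \<le> 2 ^ k"
proof -
  obtain e where "expr_val e = n" "ones_count e = complexity n"
    using complexity_attained assms(1) by blast
  then have "n \<le> 2 ^ complexity n" using expr_val_le[of e] by simp
  also have "\<dots> \<le> 2 ^ k" using assms(2) by simp
  finally show ?thesis .
qed

lemma cpx_E_attained:
  assumes "k \<ge> 1"
  shows "cpx_E k \<ge> 1 \<and> complexity (cpx_E k) \<le> k"
  unfolding cpx_E_def
  by (rule GreatestI_nat[where k = k and b = "2 ^ k"])
    (use assms complexity_le le_of_complexity_le in auto)

lemma le_cpx_E: "n \<ge> 1 \<Longrightarrow> complexity n \<le> k \<Longrightarrow> n \<le> cpx_E k"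
  unfolding cpx_E_def
  by (rule Greatest_le_nat[where b = "2 ^ k"]) (use le_of_complexity_le in auto)

lemma cpx_E_ge: "k \<ge> 1 \<Longrightarrow> k \<le> cpx_E k"
  using le_cpx_E complexity_le by blast

lemma cpx_E_1: "cpx_E 1 = 1"
proof -
  obtain e where e: "expr_val e = cpx_E 1" "ones_count e \<le> 1"
    using cpx_E_attained[of 1] complexity_attained[of "cpx_E 1"] by auto
  have "e = One"
  proof (cases e)
    case (Add f g)
    then show ?thesis using e(2) ones_count_pos[of f] ones_count_pos[of g] by simp
  next
    case (Mul f g)
    then show ?thesis using e(2) ones_count_pos[of f] ones_count_pos[of g] by simp
  qed
  with e(1) show ?thesis by simp
qed

lemma cpx_L_attained:
  assumes "n \<ge> 1"
  shows "cpx_L n \<ge> 1 \<and> cpx_E (cpx_L n) \<le> n"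
  unfolding cpx_L_def
  by (rule GreatestI_nat[where k = 1 and b = n])
    (use assms cpx_E_1 cpx_E_ge order_trans in auto)

lemma le_cpx_L: "k \<ge> 1 \<Longrightarrow> cpx_E k \<le> n \<Longrightarrow> k \<le> cpx_L n"
  unfolding cpx_L_def
  by (rule Greatest_le_nat[where b = n]) (use cpx_E_ge order_trans in auto)

lemma Field_omega_power: "Field (omega_power k) = {u. length u = k}"
proof (induction k)
  case (Suc k)
  have "u \<in> Field (omega_power (Suc k))" if "length u = Suc k" for u
  proof -
    from that obtain a v where u: "u = a # v" "length v = k" by (cases u) auto
    with Suc have "(u, Suc a # v) \<in> omega_power (Suc k)" by auto
    then show ?thesis by (rule FieldI1)
  qed
  moreover have "length u = Suc k" if "u \<in> Field (omega_power (Suc k))" for u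
    using that Suc by (auto simp: Field_def)
  ultimately show ?case by blast
qed (auto simp: Field_def)

lemma omega_power_iff:
  "(u, v) \<in> omega_power k \<longleftrightarrow>
     length u = k \<and> length v = k \<and> (u = v \<or> (u, v) \<in> lenlex less_than)"
proof (induction k arbitrary: u v)
  case (Suc k)
  show ?case
    by (cases u; cases v) (auto simp: Suc Field_omega_power Cons_lenlex_iff)
qed auto

lemma Well_order_omega_power: "Well_order (omega_power k)"
proof -
  have irr: "(u, u) \<notin> lenlex less_than" for u :: "nat list"
    by (rule lenlex_irreflexive) simp
  have tr: "trans (lenlex less_than)"
    by (rule lenlex_transI) simp
  have tot: "total (lenlex less_than)"
    by (rule total_lenlex) simp
  have "Refl (omega_power k)"
    by (auto simp: refl_on_def Field_omega_power omega_power_iff)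
  moreover have "trans (omega_power k)"
    unfolding trans_def omega_power_iff using tr by (blast dest: transD)
  moreover have "antisym (omega_power k)"
    unfolding antisym_def omega_power_iff using irr tr by (blast dest: transD)
  moreover have "Total (omega_power k)"
    using tot by (auto simp: total_on_def Field_omega_power omega_power_iff)
  moreover have "wf (omega_power k - Id)"
    by (rule wf_subset[OF wf_lenlex[OF wf_less_than]]) (auto simp: omega_power_iff)
  moreover have "omega_power k \<subseteq> Field (omega_power k) \<times> Field (omega_power k)"
    by (auto intro: FieldI1 FieldI2)
  ultimately show ?thesis
    by (simp add: well_order_on_def linear_order_on_def partial_order_on_def preorder_on_def)
qed

end

(* Give an expression of value v and cost C (not necessarily optimal) the ratio v / 3^(C/3); for
   optimal expressions this is 3^(-delta/3), so increasing defects are decreasing ratios. Let R_a be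
   the set of ratios of costs congruent to a mod 3. Along a sequence of ratios bounded away from 0,
   the cheaper summand of a sum has bounded cost, and the factors of a product other than those of
   ratio 1 have ratio at most 49/50. Hence ratios have no strictly increasing sequence, and every
   positive limit point of R_a lies in 3^(-1/3) times the closure of R_(a-1). Iterating, the infimum
   of a strictly decreasing copy of omega^k in R_a, if positive, lies in 3^(-k/3) times the closure
   of R_(a-k), so it is at most E(m) / 3^((m+k)/3) if m = a - k mod 3, m > 1; this bounds order types
   from above. Conversely, the numbers (..(E(m) 3^(i_1) + 1) 3^(i_2) + ..) 3^(i_k) + 1 give a copy
   of omega^k of ratios above this bound. Colour it by whether the obvious cost is the complexity; a
   monochromatic copy of omega^k of the bad colour would, with the cost lowered by 1, contradict the
   upper bound. *)

theory Submission
  imports Defs "HOL-Analysis.Elementary_Metric_Spaces"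
begin

section \<open>The constant 3^(-1/3), whose natural powers replace 3^(-C/3)\<close>

definition cbrt_third :: real ("\<kappa>") where
  "\<kappa> = root 3 (1 / 3)"

lemma kappa_cube: "\<kappa> ^ 3 = 1 / 3"
  by (simp add: cbrt_third_def)

lemma kappa_pos [simp]: "0 < \<kappa>"
  by (simp add: cbrt_third_def)

lemma kappa_nonneg [simp]: "0 \<le> \<kappa>"
  using kappa_pos by linarith

lemma kappa_neq_0 [simp]: "\<kappa> \<noteq> 0"
  using kappa_pos by linarith

text \<open>Here (7/10)^3 = 0.343 exceeds 1/3. The gap constant 49/50 used below is 2 *
  (7/10)^2.\<close>

lemma kappa_le: "\<kappa> \<le> 7 / 10"
proof (rule ccontr)
  assume "\<not> ?thesis"
  then have "(7 / 10) ^ 3 < \<kappa> ^ 3" by (intro power_strict_mono) auto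
  then show False unfolding kappa_cube by (simp add: power_divide)
qed

lemma kappa_gt: "1 / 2 < \<kappa>"
proof (rule ccontr)
  assume "\<not> ?thesis"
  then have "\<kappa> ^ 3 \<le> (1 / 2) ^ 3" by (intro power_mono) (auto intro: less_imp_le)
  then show False unfolding kappa_cube by (simp add: power_divide)
qed

lemma kappa_power_le: "\<kappa> ^ k \<le> (7 / 10) ^ k"
  using kappa_le by (intro power_mono) (auto intro: less_imp_le)

lemma kappa_power_decreasing: "i \<le> j \<Longrightarrow> \<kappa> ^ j \<le> \<kappa> ^ i"
  using kappa_le by (intro power_decreasing) (auto intro: less_imp_le)

lemma kappa_power_add_3: "\<kappa> ^ (k + 3) = \<kappa> ^ k / 3"
  by (simp add: power_add kappa_cube)

section \<open>Ratios\<close>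

definition ratio :: "expr \<Rightarrow> real" where
  "ratio e = real (expr_val e) * \<kappa> ^ ones_count e"

definition ratios :: "nat \<Rightarrow> real set" where
  "ratios a = {ratio e | e. ones_count e mod 3 = a mod 3}"

lemma ratio_in_ratios: "ones_count e mod 3 = a mod 3 \<Longrightarrow> ratio e \<in> ratios a"
  by (auto simp: ratios_def)

lemma ratios_cong: "a mod 3 = b mod 3 \<Longrightarrow> ratios a = ratios b"
  by (simp add: ratios_def)

lemma ratio_pos [simp]: "0 < ratio e"
  using expr_val_pos[of e] by (simp add: ratio_def)

lemma ratio_One: "ratio One = \<kappa>"
  by (simp add: ratio_def)

lemma ratio_Mul: "ratio (Mul e f) = ratio e * ratio f"
  by (simp add: ratio_def power_add)

lemma ratio_Add:
  "ratio (Add e f) = ratio e * \<kappa> ^ ones_count f + ratio f * \<kappa> ^ ones_count e"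
  by (simp add: ratio_def power_add algebra_simps)

section \<open>Selfridge's closed form for the largest value at a given cost\<close>

fun max_val :: "nat \<Rightarrow> nat" where
  "max_val 0 = 1"
| "max_val (Suc 0) = 1"
| "max_val (Suc (Suc 0)) = 2"
| "max_val (Suc (Suc (Suc 0))) = 3"
| "max_val (Suc (Suc (Suc (Suc 0)))) = 4"
| "max_val (Suc (Suc (Suc (Suc (Suc n))))) = 3 * max_val (Suc (Suc n))"

lemma max_val_small: "max_val 1 = 1" "max_val 2 = 2" "max_val 3 = 3" "max_val 4 = 4"
  by (simp_all add: eval_nat_numeral)

lemma max_val_Suc: "n \<ge> 1 \<Longrightarrow> max_val n + 1 \<le> max_val (Suc n)"
  by (induction n rule: max_val.induct) auto

lemma max_val_mono:
  assumes "1 \<le> m" "m \<le> n"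
  shows "max_val m \<le> max_val n"
  using assms(2)
proof (induction n rule: dec_induct)
  case (step n)
  then show ?case using max_val_Suc[of n] assms(1) by simp
qed simp

text \<open>Tripling holds only from index 2 on, since \<open>max_val 4\<close> exceeds
  \<open>3 * max_val 1\<close>. From m = 5 on, lowering m by 3 divides both sides by 3, so m = 1,
  ..., 4 are the base cases; the last three use the same periodicity in n.\<close>

lemma max_val_mult: "m \<ge> 1 \<Longrightarrow> n \<ge> 1 \<Longrightarrow> max_val m * max_val n \<le> max_val (m + n)"
proof (induction m rule: max_val.induct)
  case 2
  then show ?case using max_val_Suc[of n] by simp
next
  case 3
  then show ?case by (induction n rule: max_val.induct) auto
next
  case 4
  then show ?case by (induction n rule: max_val.induct) auto
next
  case 5
  then show ?case by (induction n rule: max_val.induct) auto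
qed auto

text \<open>A sum of two values that are at least 2 is dominated by their product. Adding a value 1
  is harmless because \<open>max_val\<close> grows by at least 1 whenever the cost does.\<close>

lemma expr_val_le_max_val: "expr_val e \<le> max_val (ones_count e)"
proof (induction e)
  case (Add e f)
  have *: "u + 1 \<le> max_val (a + b)" if "u \<le> max_val a" "a \<ge> 1" "b \<ge> 1" for u a b
    using max_val_Suc[of a] max_val_mono[of "Suc a" "a + b"] that by simp
  consider "expr_val f = 1" | "expr_val e = 1" | "2 \<le> expr_val e" "2 \<le> expr_val f"
    using expr_val_pos[of e] expr_val_pos[of f] by linarith
  then show ?case
  proof cases
    case 1
    then show ?thesis using *[OF Add.IH(1), of "ones_count f"] ones_count_pos by simp
  next
    case 2
    then show ?thesis using *[OF Add.IH(2), of "ones_count e"] ones_count_pos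
      by (simp add: add.commute)
  next
    case 3
    then have "expr_val e + expr_val f \<le> expr_val e * expr_val f"
      by (rule add_le_mult_if_ge_2)
    also have "\<dots> \<le> max_val (ones_count e) * max_val (ones_count f)"
      using Add.IH by (rule mult_le_mono)
    also have "\<dots> \<le> max_val (ones_count e + ones_count f)"
      using ones_count_pos by (intro max_val_mult)
    finally show ?thesis by simp
  qed
next
  case (Mul e f)
  then have "expr_val e * expr_val f \<le> max_val (ones_count e) * max_val (ones_count f)"
    by (intro mult_le_mono)
  also have "\<dots> \<le> max_val (ones_count e + ones_count f)"
    using ones_count_pos by (intro max_val_mult)
  finally show ?case by simp
qed auto

lemma max_val_attained: "k \<ge> 1 \<Longrightarrow> \<exists>e. expr_val e = max_val k \<and> ones_count e = k"
proof (induction k rule: max_val.induct)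
  case 2
  show ?case by (rule exI[of _ One]) simp
next
  case 3
  show ?case by (rule exI[of _ "Add One One"]) simp
next
  case 4
  show ?case by (rule exI[of _ "Add One (Add One One)"]) simp
next
  case 5
  show ?case by (rule exI[of _ "Add One (Add One (Add One One))"]) simp
next
  case (6 n)
  then obtain e where "expr_val e = max_val (Suc (Suc n))" "ones_count e = Suc (Suc n)" by auto
  then show ?case by (intro exI[of _ "Mul e (Add One (Add One One))"]) simp
qed simp

text \<open>Multiplication by \<open>One\<close> wastes one unit of cost without changing the
  value.\<close>

lemma expr_with_cost:
  assumes "n \<ge> 1" "complexity n \<le> k"
  shows "\<exists>e. expr_val e = n \<and> ones_count e = k"
  using assms(2)
proof (induction k rule: dec_induct)
  case base
  then show ?case using complexity_attained[OF assms(1)] .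
next
  case (step k)
  then obtain e where "expr_val e = n" "ones_count e = k" by blast
  then show ?case by (intro exI[of _ "Mul e One"]) simp
qed

lemma complexity_expr_val_le: "complexity (expr_val e) \<le> ones_count e"
  unfolding complexity_def by (rule Least_le) blast

lemma cpx_E_ge_max_val: "k \<ge> 1 \<Longrightarrow> max_val k \<le> cpx_E k"
  using max_val_attained[of k] complexity_expr_val_le expr_val_pos le_cpx_E by metis

text \<open>For \<open>k \<ge> 2\<close> this depends on \<open>k\<close> modulo 3 only.\<close>

definition max_ratio :: "nat \<Rightarrow> real" where
  "max_ratio k = real (max_val k) * \<kappa> ^ k"

lemma max_ratio_add_3: "k \<ge> 2 \<Longrightarrow> max_ratio (k + 3) = max_ratio k"
proof -
  assume "k \<ge> 2"
  then obtain j where "k = Suc (Suc j)" by (metis add_2_eq_Suc le_Suc_ex)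
  then have "max_val (k + 3) = 3 * max_val k" by (simp add: eval_nat_numeral)
  then show ?thesis unfolding max_ratio_def kappa_power_add_3 by simp
qed

lemma max_ratio_cases:
  "k \<ge> 2 \<Longrightarrow>
     max_ratio k = max_ratio (if k mod 3 = 0 then 3 else if k mod 3 = 1 then 4 else 2)"
proof (induction k rule: less_induct)
  case (less k)
  consider "k \<ge> 5" | "k = 2" | "k = 3" | "k = 4" using less.prems by linarith
  then show ?case
  proof cases
    case 1
    define j where "j = k - 3"
    have j: "k = j + 3" "j \<ge> 2" "j < k" "k mod 3 = j mod 3"
      using 1 by (auto simp: j_def le_mod_geq)
    then show ?thesis using less.IH[of j] max_ratio_add_3[of j] by simp
  qed auto
qed

lemma max_ratio_small:
  "max_ratio 1 = \<kappa>" "max_ratio 2 = 2 * \<kappa>\<^sup>2" "max_ratio 3 = 1" "max_ratio 4 = 4 / 3 * \<kappa>"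
  using kappa_power_add_3[of 1] kappa_power_add_3[of 0]
  by (simp_all add: max_ratio_def eval_nat_numeral)

text \<open>Only the values at 2, 3 and 4 occur. At k = 1 the strict bound would fail, as
  \<open>max_ratio 1\<close> is \<open>\<kappa>\<close> itself. The strict bound later pushes a
  ratio divided by \<open>\<kappa>\<close> above 1.\<close>

lemma max_ratio_range:
  assumes "k \<ge> 2"
  shows "\<kappa> < max_ratio k" "max_ratio k \<le> 1"
proof -
  have k: "max_ratio k = max_ratio 2 \<or> max_ratio k = max_ratio 3 \<or> max_ratio k = max_ratio 4"
    using max_ratio_cases[OF assms] by presburger
  have "\<kappa> < 2 * \<kappa>\<^sup>2" using kappa_gt by (simp add: power2_eq_square)
  moreover have "2 * \<kappa>\<^sup>2 \<le> 1" using kappa_power_le[of 2] by (simp add: power2_eq_square)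
  ultimately show "\<kappa> < max_ratio k" "max_ratio k \<le> 1"
    using k kappa_le kappa_pos unfolding max_ratio_small by (auto simp del: kappa_pos)
qed

lemma max_ratio_le:
  assumes "j \<ge> 1" "k \<ge> 2" "j mod 3 = k mod 3"
  shows "max_ratio j \<le> max_ratio k"
proof (cases "j = 1")
  case True
  then show ?thesis using max_ratio_range(1)[OF assms(2)] by (simp add: max_ratio_small(1)[simplified])
next
  case False
  then have "max_ratio j = max_ratio k"
    using assms max_ratio_cases[of j] max_ratio_cases[of k] by simp
  then show ?thesis by simp
qed

lemma ratio_le_max_ratio: "ratio e \<le> max_ratio (ones_count e)"
  using expr_val_le_max_val[of e] by (simp add: ratio_def max_ratio_def)

lemma ratio_le_1: "ratio e \<le> 1"
proof (cases "ones_count e = 1")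
  case True
  then show ?thesis using ratio_le_max_ratio[of e] kappa_le max_ratio_small(1) by simp
next
  case False
  then have "ones_count e \<ge> 2" using ones_count_pos[of e] by linarith
  then show ?thesis using ratio_le_max_ratio[of e] max_ratio_range(2) by (meson order_trans)
qed

text \<open>Half-lines {..b} are closed, so bounds on ratios pass to limits. The second bound fails
  for k = 1: cost 4 reaches the ratio 4/3 * \<open>\<kappa>\<close>, more than E(1) *
  \<open>\<kappa>\<close>.\<close>

lemma closure_ratios_le:
  assumes "x \<in> closure (ratios k)"
  shows "x \<le> 1" "k \<ge> 2 \<Longrightarrow> x \<le> real (cpx_E k) * \<kappa> ^ k"
proof -
  have *: "closure (ratios k) \<subseteq> {..b}" if "\<And>e. ones_count e mod 3 = k mod 3 \<Longrightarrow> ratio e \<le> b" for b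
    using that by (intro closure_minimal) (auto simp: ratios_def)
  show "x \<le> 1" using *[of 1] ratio_le_1 assms by auto
  assume k: "k \<ge> 2"
  have "ratio e \<le> real (cpx_E k) * \<kappa> ^ k" if "ones_count e mod 3 = k mod 3" for e
  proof -
    have "ratio e \<le> max_ratio k"
      using ratio_le_max_ratio[of e] max_ratio_le[OF ones_count_pos k that] by linarith
    also have "\<dots> \<le> real (cpx_E k) * \<kappa> ^ k"
      using cpx_E_ge_max_val[of k] k by (simp add: max_ratio_def)
    finally show ?thesis .
  qed
  then show "x \<le> real (cpx_E k) * \<kappa> ^ k" using * assms by auto
qed

lemma ratio_eq_1D:
  assumes "ratio e = 1"
  shows "ones_count e mod 3 = 0"
proof (rule ccontr)
  assume nz: "ones_count e mod 3 \<noteq> 0"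
  have "ratio e < 1"
  proof (cases "ones_count e = 1")
    case True
    then show ?thesis using ratio_le_max_ratio[of e] kappa_le max_ratio_small(1) by simp
  next
    case False
    then have "ones_count e \<ge> 2" using ones_count_pos[of e] by linarith
    then have "max_ratio (ones_count e) = max_ratio 4 \<or> max_ratio (ones_count e) = max_ratio 2"
      using max_ratio_cases[of "ones_count e"] nz by presburger
    moreover have "2 * \<kappa>\<^sup>2 < 1" using kappa_power_le[of 2] by (simp add: power2_eq_square)
    ultimately show ?thesis using ratio_le_max_ratio[of e] kappa_le
      unfolding max_ratio_small by auto
  qed
  with assms show False by simp
qed

section \<open>The gap of the ratios below 1, and a normal form\<close>

lemma ratio_Add_le: "ratio (Add e f) \<le> \<kappa> ^ ones_count f + \<kappa> ^ ones_count e"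
  unfolding ratio_Add
  using ratio_le_1 by (intro add_mono mult_left_le_one_le) (auto intro: less_imp_le)

text \<open>The sum of two powers of \<open>\<kappa>\<close> is small enough unless the costs are
  (1,1), (2,1) or (3,1). These are checked by hand; ratio 1 arises only from 2 + 1.\<close>

lemma ratio_Add_gap:
  assumes "ones_count f \<le> ones_count e"
  shows "ratio (Add e f) = 1 \<or> ratio (Add e f) \<le> 49 / 50"
proof -
  note le = ratio_Add_le[of e f]
  have k2: "\<kappa>\<^sup>2 \<le> 49 / 100" using kappa_power_le[of 2] by (simp add: power2_eq_square)
  have k4: "\<kappa> ^ 4 \<le> 2401 / 10000" using kappa_power_le[of 4] by (simp add: power_divide)
  consider "ones_count f \<ge> 2" | "ones_count f = 1" "ones_count e \<ge> 4"
    | "ones_count f = 1" "ones_count e = 1" | "ones_count f = 1" "ones_count e = 2"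
    | "ones_count f = 1" "ones_count e = 3"
    using ones_count_pos[of f] assms by linarith
  then show ?thesis
  proof cases
    case 1
    then show ?thesis
      using le k2 kappa_power_decreasing[of 2 "ones_count f"]
        kappa_power_decreasing[of 2 "ones_count e"] assms by linarith
  next
    case 2
    then show ?thesis
      using le k4 kappa_le kappa_power_decreasing[OF 2(2)] unfolding 2(1) power_one_right by linarith
  next
    case 3
    then have "expr_val e = 1" "expr_val f = 1"
      using expr_val_le_max_val[of e] expr_val_le_max_val[of f] expr_val_pos[of e] expr_val_pos[of f]
      by simp_all
    with 3 show ?thesis using k2 by (simp add: ratio_def power2_eq_square)
  next
    case 4
    have "expr_val e \<le> 2" "expr_val f \<le> 1"
      using expr_val_le_max_val[of e] expr_val_le_max_val[of f] unfolding 4 max_val_small .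
    then have "expr_val e = 1 \<or> expr_val e = 2" "expr_val f = 1"
      using expr_val_pos[of e] expr_val_pos[of f] by linarith+
    moreover have "\<kappa> ^ ones_count (Add e f) = 1 / 3" using 4 kappa_cube by (simp add: eval_nat_numeral)
    ultimately show ?thesis by (auto simp: ratio_def)
  next
    case 5
    have "expr_val e \<le> 3" "expr_val f \<le> 1"
      using expr_val_le_max_val[of e] expr_val_le_max_val[of f] unfolding 5 max_val_small .
    then have "real (expr_val (Add e f)) \<le> 4" by simp
    moreover have "\<kappa> ^ ones_count (Add e f) = \<kappa> ^ 4" using 5 by (simp add: eval_nat_numeral)
    ultimately have "ratio (Add e f) \<le> 4 * \<kappa> ^ 4"
      unfolding ratio_def by (simp add: mult_right_mono less_imp_le)
    then show ?thesis using k4 by linarith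
  qed
qed

lemma ratio_gap: "ratio e = 1 \<or> ratio e \<le> 49 / 50"
proof (induction e)
  case One
  then show ?case using kappa_le by (simp add: ratio_One)
next
  case (Add e f)
  have "ratio (Add e f) = ratio (Add f e)" by (simp add: ratio_Add)
  then show ?case using ratio_Add_gap[of f e] ratio_Add_gap[of e f] by (metis linear)
next
  case (Mul e f)
  then show ?case
    using mult_mono[of "ratio e" "49/50" "ratio f" 1] mult_mono[of "ratio e" 1 "ratio f" "49/50"]
      ratio_le_1[of e] ratio_le_1[of f] ratio_pos[of e] ratio_pos[of f]
    by (auto simp: ratio_Mul simp del: ratio_pos)
qed

text \<open>The condition concerns the root only, because the limit argument takes apart one
  operation at a time.\<close>

definition reduced :: "expr \<Rightarrow> bool" where
  "reduced e \<longleftrightarrow> e = One \<or> (\<exists>f g. e = Add f g \<and> ones_count g \<le> ones_count f) \<or>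
     (\<exists>f g. e = Mul f g \<and> ratio f \<le> 49 / 50 \<and> ratio g \<le> 49 / 50)"

text \<open>Summands are swapped if necessary, and factors of ratio 1 are dropped. The latter
  changes value and cost, but neither the ratio nor, by \<open>ratio_eq_1D\<close>, the residue of
  the cost.\<close>

lemma reduced_exists:
  "\<exists>e'. reduced e' \<and> ratio e' = ratio e \<and> ones_count e' mod 3 = ones_count e mod 3"
proof (induction e)
  case One
  show ?case by (rule exI[of _ One]) (simp add: reduced_def)
next
  case (Add e f)
  show ?case
  proof (cases "ones_count f \<le> ones_count e")
    case True
    then show ?thesis by (intro exI[of _ "Add e f"]) (simp add: reduced_def)
  next
    case False
    then show ?thesis
      by (intro exI[of _ "Add f e"]) (simp add: reduced_def ratio_Add add.commute)
  qed
next
  case (Mul e f)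
  consider "ratio e = 1" | "ratio f = 1" | "ratio e \<le> 49 / 50" "ratio f \<le> 49 / 50"
    using ratio_gap by blast
  then show ?case
  proof cases
    case 1
    from ratio_eq_1D[OF this] have "ones_count (Mul e f) mod 3 = ones_count f mod 3" by auto
    then show ?thesis using Mul.IH(2) 1 by (simp add: ratio_Mul)
  next
    case 2
    from ratio_eq_1D[OF this] have "ones_count (Mul e f) mod 3 = ones_count e mod 3" by auto
    then show ?thesis using Mul.IH(1) 2 by (simp add: ratio_Mul)
  next
    case 3
    then show ?thesis by (intro exI[of _ "Mul e f"]) (simp add: reduced_def)
  qed
qed

section \<open>Limits of ratios\<close>

text \<open>Modulo 3, subtracting d is the same as adding 2d; this form avoids truncated
  subtraction.\<close>

lemma mod_3_shift:
  fixes x :: nat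
  assumes "(x + d) mod 3 = a mod 3"
  shows "x mod 3 = (a + 2 * d) mod 3"
proof -
  have "x + d + 2 * d = x + d * 3" by simp
  then have "x mod 3 = (x + d + 2 * d) mod 3" by (simp only: mod_mult_self1)
  then show ?thesis using mod_add_cong[OF assms refl] by metis
qed

lemma closure_ratios_mult:
  assumes "x \<in> closure (ratios a)" "y \<in> closure (ratios b)"
  shows "x * y \<in> closure (ratios (a + b))"
proof -
  obtain f g where f: "\<And>n. f n \<in> ratios a" "f \<longlonglongrightarrow> x" and g: "\<And>n. g n \<in> ratios b" "g \<longlonglongrightarrow> y"
    using assms unfolding closure_sequential by blast
  have "f n * g n \<in> ratios (a + b)" for n
  proof -
    obtain e e' where "f n = ratio e" "ones_count e mod 3 = a mod 3"
      "g n = ratio e'" "ones_count e' mod 3 = b mod 3"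
      using f(1)[of n] g(1)[of n] by (auto simp: ratios_def)
    then show ?thesis
      using mod_add_cong[of "ones_count e" 3 a "ones_count e'" b]
      by (auto simp: ratios_def ratio_Mul intro!: exI[of _ "Mul e e'"])
  qed
  moreover have "(\<lambda>n. f n * g n) \<longlonglongrightarrow> x * y" using f g by (intro tendsto_mult)
  ultimately show ?thesis
    unfolding closure_sequential by (intro exI[of _ "\<lambda>n. f n * g n"]) simp
qed

lemma kappa_power_mult_closure:
  assumes "x \<in> closure (ratios a)"
  shows "\<kappa> ^ k * x \<in> closure (ratios (a + k))"
proof (induction k)
  case 0
  then show ?case using assms by simp
next
  case (Suc k)
  have "\<kappa> \<in> ratios 1" using ratio_in_ratios[of One 1] by (simp add: ratio_One)
  then have "\<kappa> \<in> closure (ratios 1)" using closure_subset by blast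
  from closure_ratios_mult[OF this Suc.IH] show ?case by (simp add: mult.assoc)
qed

section \<open>Extraction of subsequences\<close>

lemma strict_subseq_of_rel:
  fixes P :: "'a \<Rightarrow> 'a \<Rightarrow> bool" and s :: "nat \<Rightarrow> 'a"
  assumes "\<And>m. \<exists>n>m. P (s m) (s n)"
  shows "\<exists>f. strict_mono f \<and> (\<forall>i. P (s (f i)) (s (f (Suc i))))"
proof -
  have "\<exists>f. \<forall>i. f i < f (Suc i) \<and> P (s (f i)) (s (f (Suc i)))"
    using dependent_nat_choice[of "\<lambda>_ _. True" "\<lambda>_ m n. m < n \<and> P (s m) (s n)"] assms by auto
  then show ?thesis by (auto simp: strict_mono_Suc_iff)
qed

lemma subseq_const_or_strict:
  fixes s :: "nat \<Rightarrow> real"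
  shows "\<exists>f :: nat \<Rightarrow> nat. strict_mono f \<and> ((\<forall>i. s (f i) = s (f 0)) \<or> strict_mono (\<lambda>i. s (f i)) \<or>
    strict_mono (\<lambda>i. - s (f i)))"
proof -
  have *: "\<exists>f :: nat \<Rightarrow> nat. strict_mono f \<and> ((\<forall>i. t (f i) = t (f 0)) \<or> strict_mono (\<lambda>i. t (f i)))"
    if t: "mono t" for t :: "nat \<Rightarrow> real"
  proof (cases "\<forall>m. \<exists>n>m. t m < t n")
    case True
    then obtain f where "strict_mono f" "\<And>i. t (f i) < t (f (Suc i))"
      using strict_subseq_of_rel[of "(<)" t] by blast
    then have "strict_mono (\<lambda>i. t (f i))" by (simp add: strict_mono_Suc_iff)
    with \<open>strict_mono f\<close> show ?thesis by blast
  next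
    case False
    then obtain m where m: "\<And>n. n > m \<Longrightarrow> t n \<le> t m" by force
    have "t (m + i) = t m" for i
      using m[of "m + i"] monoD[OF t, of m "m + i"] by (cases "i = 0") auto
    then show ?thesis by (intro exI[of _ "\<lambda>i. m + i"]) (auto simp: strict_mono_def)
  qed
  obtain f where f: "strict_mono f" "monoseq (\<lambda>n. s (f n))" using seq_monosub by blast
  consider "mono (\<lambda>n. s (f n))" | "mono (\<lambda>n. - s (f n))"
    using f(2) by (auto simp: monoseq_def mono_def)
  then show ?thesis
  proof cases
    case 1
    from *[OF this] obtain g :: "nat \<Rightarrow> nat" where "strict_mono g"
      "(\<forall>i. s (f (g i)) = s (f (g 0))) \<or> strict_mono (\<lambda>i. s (f (g i)))" by blast
    then show ?thesis
      using f(1) by (intro exI[of _ "f \<circ> g"]) (auto intro: strict_mono_o)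
  next
    case 2
    from *[OF this] obtain g :: "nat \<Rightarrow> nat" where "strict_mono g"
      "(\<forall>i. s (f (g i)) = s (f (g 0))) \<or> strict_mono (\<lambda>i. - s (f (g i)))" by auto
    then show ?thesis
      using f(1) by (intro exI[of _ "f \<circ> g"]) (auto intro: strict_mono_o)
  qed
qed

lemma subseq_const_of_finite:
  assumes "finite (range s)"
  shows "\<exists>f::nat \<Rightarrow> nat. strict_mono f \<and> (\<forall>i. s (f i) = s (f 0))"
proof -
  obtain m where m: "infinite {n. s n = s m}"
    using pigeonhole_infinite[of "UNIV :: nat set" s] assms by auto
  from infinite_enumerate[OF this] obtain f :: "nat \<Rightarrow> nat"
    where f: "strict_mono f" "\<forall>i. f i \<in> {n. s n = s m}" by blast
  then have "s (f i) = s m" for i by simp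
  with f(1) show ?thesis by (intro exI[of _ f]) simp
qed

lemma expr_val_le_power: "ones_count e \<le> b \<Longrightarrow> expr_val e \<le> 2 ^ b"
  by (rule order_trans[OF expr_val_le power_increasing]) auto

text \<open>A positive limit bounds the cost of the cheaper summand, so by pigeonhole its value and
  cost may be taken constant. The ratios being distinct, the cost of the other summand must then be
  unbounded.\<close>

lemma Add_subseq:
  assumes le: "\<And>i. ones_count (g i) \<le> ones_count (f i)"
    and inj: "inj (\<lambda>i. ratio (Add (f i) (g i)))"
    and lim: "(\<lambda>i. ratio (Add (f i) (g i))) \<longlonglongrightarrow> l" and "l > 0"
  shows "\<exists>r d v. strict_mono (r :: nat \<Rightarrow> nat) \<and> strict_mono (\<lambda>i. ones_count (f (r i))) \<and>
    (\<forall>i. ones_count (g (r i)) = d \<and> expr_val (g (r i)) = v)"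
proof -
  let ?x = "\<lambda>i. ratio (Add (f i) (g i))"
  \<comment> \<open>If both summands cost at least B, the ratio of the sum is below 2 * l/4,
    contradicting that it is eventually above l/2.\<close>
  obtain B where B: "\<kappa> ^ B < l / 4"
    using real_arch_pow_inv[of "l / 4" \<kappa>] \<open>l > 0\<close> kappa_le by auto
  have "eventually (\<lambda>i. l / 2 < ?x i) sequentially"
    using order_tendstoD(1)[OF lim, of "l / 2"] \<open>l > 0\<close> by simp
  then obtain N where N: "\<And>i. i \<ge> N \<Longrightarrow> l / 2 < ?x i"
    by (auto simp: eventually_sequentially)
  have cost: "ones_count (g i) < B" if "i \<ge> N" for i
  proof (rule ccontr)
    assume "\<not> ?thesis"
    then have "\<kappa> ^ ones_count (g i) \<le> \<kappa> ^ B" "\<kappa> ^ ones_count (f i) \<le> \<kappa> ^ B"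
      using le[of i] by (auto intro!: kappa_power_decreasing)
    then show False using B N[OF that] ratio_Add_le[of "f i" "g i"] by linarith
  qed
  define p where "p i = (expr_val (g (N + i)), ones_count (g (N + i)))" for i
  have "p i \<in> {..2 ^ B} \<times> {..B}" for i
    using cost[of "N + i"] expr_val_le_power[of "g (N + i)" B] by (simp add: p_def)
  then have "range p \<subseteq> {..2 ^ B} \<times> {..B}" by (rule image_subsetI)
  then have "finite (range p)" by (rule finite_subset) simp
  then obtain s :: "nat \<Rightarrow> nat" where s: "strict_mono s" "\<And>i. p (s i) = p (s 0)"
    using subseq_const_of_finite[of p] by blast
  define t where "t i = ones_count (f (N + s i))" for i
  \<comment> \<open>Otherwise the costs of the larger summands are bounded from some index on, only
    finitely many pairs of value and cost remain, and two of the sums have the same ratio.\<close>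
  have "\<exists>n>m. t m < t n" for m
  proof (rule ccontr)
    assume "\<not> ?thesis"
    then have t: "t n \<le> t m" if "n > m" for n using that by force
    let ?h = "\<lambda>i. N + s (Suc (m + i))"
    define z where "z i = (expr_val (f (?h i)), ones_count (f (?h i)))" for i
    have "z i \<in> {..2 ^ t m} \<times> {..t m}" for i
      using t[of "Suc (m + i)"] expr_val_le_power[of "f (?h i)" "t m"] by (simp add: z_def t_def)
    then have "range z \<subseteq> {..2 ^ t m} \<times> {..t m}" by (rule image_subsetI)
    then have "finite (range z)" by (rule finite_subset) simp
    then obtain q :: "nat \<Rightarrow> nat" where q: "strict_mono q" "\<And>i. z (q i) = z (q 0)"
      using subseq_const_of_finite[of z] by blast
    have "?x (?h (q 1)) = ?x (?h (q 0))"
      using q(2)[of 1] s(2)[of "Suc (m + q 1)"] s(2)[of "Suc (m + q 0)"]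
      by (simp add: z_def p_def ratio_def)
    then have "?h (q 1) = ?h (q 0)" using inj by (auto dest: injD)
    then have "q 1 = q 0" using s(1) by (simp add: strict_mono_eq)
    then show False using q(1) by (simp add: strict_mono_eq)
  qed
  then obtain q where q: "strict_mono q" "\<And>i. t (q i) < t (q (Suc i))"
    using strict_subseq_of_rel[of "(<)" t] by blast
  show ?thesis
  proof (intro exI conjI allI)
    show "strict_mono (\<lambda>i. N + s (q i))"
      using s(1) q(1) by (auto simp: strict_mono_def)
    show "strict_mono (\<lambda>i. ones_count (f (N + s (q i))))"
      using q(2) by (simp add: strict_mono_Suc_iff t_def)
    show "ones_count (g (N + s (q i))) = snd (p (s 0))" for i
      using s(2)[of "q i"] by (simp add: p_def)
    show "expr_val (g (N + s (q i))) = fst (p (s 0))" for i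
      using s(2)[of "q i"] by (simp add: p_def)
  qed
qed

section \<open>Limits of monotone sequences of ratios\<close>

lemma ratio_seq_convergent:
  assumes "(\<forall>i. ratio (e i) = ratio (e 0)) \<or> strict_mono (\<lambda>i. ratio (e i)) \<or>
    strict_mono (\<lambda>i. - ratio (e i))"
  obtains l where "(\<lambda>i. ratio (e i)) \<longlonglongrightarrow> l"
proof -
  have "monoseq (\<lambda>i. ratio (e i))"
    using assms
  proof (elim disjE)
    assume "\<forall>i. ratio (e i) = ratio (e 0)"
    then show ?thesis by (metis monoI1 order_refl)
  next
    assume "strict_mono (\<lambda>i. ratio (e i))"
    from strict_mono_less_eq[OF this] show ?thesis by (auto simp: monoseq_def)
  next
    assume "strict_mono (\<lambda>i. - ratio (e i))"
    from strict_mono_less_eq[OF this] show ?thesis by (auto simp: monoseq_def)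
  qed
  moreover have "Bseq (\<lambda>i. ratio (e i))"
    using ratio_le_1 ratio_pos by (intro BseqI'[of _ 1]) (simp add: less_imp_le abs_of_pos)
  ultimately show ?thesis using that Bseq_monoseq_convergent by (blast dest: convergentD)
qed

lemma ratio_limit_in_closure:
  assumes "\<And>i. ones_count (e i) mod 3 = a mod 3" "(\<lambda>i. ratio (e i)) \<longlonglongrightarrow> l"
  shows "l \<in> closure (ratios a)"
  unfolding closure_sequential using assms by (intro exI[of _ "\<lambda>i. ratio (e i)"]) (auto simp: ratios_def)

lemma strict_mono_either_inj:
  fixes x :: "nat \<Rightarrow> real"
  assumes "strict_mono x \<or> strict_mono (\<lambda>i. - x i)"
  shows "inj x"
  using assms strict_mono_eq unfolding inj_def by (metis neg_equal_iff_equal)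

text \<open>In a reduced product both factors are at most 49/50, so the limits of both factors exceed the
  limit of the product by at least the factor 50/49, and likewise for the larger summand of a sum: this is
  what makes the induction on \<open>m\<close> work.\<close>

lemma ratio_limit_aux:
  assumes "\<And>i. ones_count (e i) mod 3 = a mod 3"
    and "strict_mono (\<lambda>i. ratio (e i)) \<or> strict_mono (\<lambda>i. - ratio (e i))"
    and "(\<lambda>i. ratio (e i)) \<longlonglongrightarrow> l" "(49 / 50) ^ m < l"
  shows "\<not> strict_mono (\<lambda>i. ratio (e i)) \<and> (\<exists>y\<in>closure (ratios (a + 2)). l = \<kappa> * y)"
  using assms
proof (induction m arbitrary: a e l)
  \<comment> \<open>Vacuous: the limit would exceed 1.\<close>
  case 0
  have "l \<le> 1" using 0(3) ratio_le_1 by (intro LIMSEQ_le_const2) auto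
  with 0(4) show ?case by simp
next
  case (Suc m)
  note IH = Suc.IH and cls = Suc.prems(1) and str = Suc.prems(2) and lim = Suc.prems(3)
  have "l > 0" using Suc.prems(4) by (meson order_le_less_trans zero_le_divide_iff zero_le_numeral zero_le_power)
  define x where "x i = ratio (e i)" for i
  have inj: "inj x" using strict_mono_either_inj[OF str] unfolding x_def .
  have limsub: "(\<lambda>i. x (r i)) \<longlonglongrightarrow> l" if "strict_mono r" for r
    using LIMSEQ_subseq_LIMSEQ[OF lim that] by (simp add: x_def o_def)
  obtain e' where e': "\<And>i. reduced (e' i)" "\<And>i. ratio (e' i) = x i"
      "\<And>i. ones_count (e' i) mod 3 = a mod 3"
    using reduced_exists[of "e _"] cls unfolding x_def by metis
  \<comment> \<open>Pigeonhole on the root operation: a subsequence uses only one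
    constructor.\<close>
  define kind where "kind i = (if e' i = One then 0 else if \<exists>f g. e' i = Add f g then 1 else 2 :: nat)"
    for i
  have kind: "kind i = 0 \<longleftrightarrow> e' i = One" "kind i = 1 \<Longrightarrow> \<exists>f g. e' i = Add f g"
      "kind i = 2 \<Longrightarrow> e' i \<noteq> One \<and> (\<nexists>f g. e' i = Add f g)" for i
    by (auto simp: kind_def split: if_splits)
  have "finite (range kind)" by (rule finite_subset[of _ "{..2}"]) (auto simp: kind_def)
  then obtain s :: "nat \<Rightarrow> nat" where s: "strict_mono s" "\<And>i. kind (s i) = kind (s 0)"
    using subseq_const_of_finite[of kind] by blast
  have injs: "inj (\<lambda>i. x (s i))"
    using inj_compose[OF inj strict_mono_imp_inj_on[OF s(1)]] by (simp add: o_def)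
  consider "kind (s 0) = 0" | "kind (s 0) = 1" | "kind (s 0) = 2"
    unfolding kind_def by (metis (full_types))
  then show ?case
  proof cases
    case 1
    then have "e' (s 0) = One" "e' (s 1) = One"
      using s(2)[of 1] by (simp_all add: kind(1) flip: kind(1))
    then have "x (s 0) = x (s 1)" by (metis e'(2))
    then show ?thesis using injs by (auto dest: injD)
  next
    case 2
    have "\<exists>f g. e' (s i) = Add f g \<and> ones_count g \<le> ones_count f" for i
    proof -
      have "\<exists>f g. e' (s i) = Add f g" using s(2)[of i] 2 by (intro kind(2)) simp
      then show ?thesis using e'(1)[of "s i"] unfolding reduced_def by force
    qed
    then obtain f g where fg: "\<And>i. e' (s i) = Add (f i) (g i)"
        "\<And>i. ones_count (g i) \<le> ones_count (f i)" by metis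
    have xs: "ratio (Add (f i) (g i)) = x (s i)" for i using e'(2)[of "s i"] fg(1) by simp
    obtain r d v where r: "strict_mono (r :: nat \<Rightarrow> nat)" "strict_mono (\<lambda>i. ones_count (f (r i)))"
        "\<And>i. ones_count (g (r i)) = d" "\<And>i. expr_val (g (r i)) = v"
      using Add_subseq[of g f l] fg(2) injs limsub[OF s(1)] \<open>l > 0\<close> unfolding xs by blast
    have srm: "strict_mono (\<lambda>i. s (r i))" using s(1) r(1) by (auto simp: strict_mono_def)
    define y where "y i = ratio (f (r i))" for i
    \<comment> \<open>The contribution of the constant summand, which vanishes in the limit as the
      cost of the other summand grows. Hence the larger summands alone have ratios tending to l /
      \<open>\<kappa> ^ d\<close>.\<close>
    define w where "w i = real v * \<kappa> ^ d * \<kappa> ^ ones_count (f (r i))" for i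
    have xyw: "x (s (r i)) = y i * \<kappa> ^ d + w i" for i
      using xs[of "r i"] r(3,4)[of i] unfolding ratio_Add y_def w_def
      by (simp add: ratio_def[of "g (r i)"])
    then have y: "y i = (x (s (r i)) - w i) / \<kappa> ^ d" for i by simp
    have "norm \<kappa> < 1" using kappa_le by (simp add: abs_of_pos)
    then have "(\<lambda>i. \<kappa> ^ ones_count (f (r i))) \<longlonglongrightarrow> 0"
      using LIMSEQ_subseq_LIMSEQ[OF LIMSEQ_power_zero[of \<kappa>] r(2)] by (simp add: o_def)
    then have "w \<longlonglongrightarrow> 0" unfolding w_def by (rule tendsto_mult_right_zero)
    then have "(\<lambda>i. (x (s (r i)) - w i) / \<kappa> ^ d) \<longlonglongrightarrow> (l - 0) / \<kappa> ^ d"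
      using limsub[OF srm] by (intro tendsto_intros) auto
    then have ylim: "(\<lambda>i. ratio (f (r i))) \<longlonglongrightarrow> l / \<kappa> ^ d"
      unfolding y[symmetric] by (simp add: y_def)
    have ycls: "ones_count (f (r i)) mod 3 = (a + 2 * d) mod 3" for i
    proof -
      have "(ones_count (f (r i)) + d) mod 3 = a mod 3"
        using e'(3)[of "s (r i)"] r(3)[of i] by (simp add: fg(1))
      then show ?thesis by (rule mod_3_shift)
    qed
    obtain d' where d': "d = Suc d'" using r(3)[of 0] ones_count_pos[of "g (r 0)"] by (cases d) auto
    \<comment> \<open>Of the d units of cost removed, d - 1 are restored by multiplications with 1,
      so that a single factor \<open>\<kappa>\<close> is split off from l.\<close>
    have "\<kappa> ^ d' * (l / \<kappa> ^ d) \<in> closure (ratios (a + 2 * d + d'))"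
      by (intro kappa_power_mult_closure ratio_limit_in_closure[OF ycls ylim])
    moreover have "ratios (a + 2 * d + d') = ratios (a + 2)"
    proof (rule ratios_cong)
      have "a + 2 * d + d' = a + 2 + d' * 3" using d' by simp
      then show "(a + 2 * d + d') mod 3 = (a + 2) mod 3" by (simp only: mod_mult_self1)
    qed
    moreover have "l = \<kappa> * (\<kappa> ^ d' * (l / \<kappa> ^ d))" using d' kappa_pos by simp
    \<comment> \<open>If x increased, so would y, since w decreases. But the limit of y is larger
      than l by a factor of at least 50/49, so the induction hypothesis applies to y.\<close>
    moreover have "\<not> strict_mono x"
    proof
      assume "strict_mono x"
      have "strict_mono y"
      proof (rule strict_monoI)
        fix i j :: nat
        assume "i < j"
        then have "x (s (r i)) < x (s (r j))"
          using strict_monoD[OF \<open>strict_mono x\<close> strict_monoD[OF srm]] by blast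
        moreover have "w j \<le> w i"
          unfolding w_def using strict_monoD[OF r(2) \<open>i < j\<close>]
          by (intro mult_left_mono kappa_power_decreasing) (auto intro: less_imp_le)
        ultimately show "y i < y j" unfolding y by (intro divide_strict_right_mono) auto
      qed
      moreover have "(49 / 50) ^ m < l / \<kappa> ^ d"
      proof -
        have "1 \<le> d" using d' by simp
        then have "\<kappa> ^ d \<le> 49 / 50"
          using kappa_power_decreasing[of 1 d] kappa_le unfolding power_one_right by linarith
        then have "(49 / 50) ^ m * \<kappa> ^ d \<le> (49 / 50) ^ m * (49 / 50 :: real)"
          by (intro mult_left_mono) auto
        also have "\<dots> < l" using Suc.prems(4) by simp
        finally show ?thesis by (simp add: pos_less_divide_eq)
      qed
      ultimately show False
        using IH[of "\<lambda>i. f (r i)" "a + 2 * d", OF ycls _ ylim] unfolding y_def by blast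
    qed
    ultimately show ?thesis unfolding x_def by metis
  next
    case 3
    have "\<exists>f g. e' (s i) = Mul f g \<and> ratio f \<le> 49 / 50 \<and> ratio g \<le> 49 / 50" for i
    proof -
      have "e' (s i) \<noteq> One \<and> (\<nexists>f g. e' (s i) = Add f g)"
        using s(2)[of i] 3 by (intro kind(3)) simp
      then show ?thesis using e'(1)[of "s i"] unfolding reduced_def by blast
    qed
    then obtain f g where fg: "\<And>i. e' (s i) = Mul (f i) (g i)"
        "\<And>i. ratio (f i) \<le> 49 / 50" "\<And>i. ratio (g i) \<le> 49 / 50" by metis
    \<comment> \<open>Three successive subsequences: the residues of both costs become constant,
      then each of the two factors becomes constant or strictly monotone in ratio.\<close>
    define p where "p i = (ones_count (f i) mod 3, ones_count (g i) mod 3)" for i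
    have "finite (range p)" by (rule finite_subset[of _ "{..2} \<times> {..2}"]) (auto simp: p_def)
    then obtain r1 :: "nat \<Rightarrow> nat" where r1: "strict_mono r1" "\<And>i. p (r1 i) = p (r1 0)"
      using subseq_const_of_finite[of p] by blast
    obtain r2 :: "nat \<Rightarrow> nat" where r2: "strict_mono r2"
      "(\<forall>i. ratio (f (r1 (r2 i))) = ratio (f (r1 (r2 0)))) \<or>
       strict_mono (\<lambda>i. ratio (f (r1 (r2 i)))) \<or> strict_mono (\<lambda>i. - ratio (f (r1 (r2 i))))"
      using subseq_const_or_strict[of "\<lambda>i. ratio (f (r1 i))"] by blast
    obtain r3 :: "nat \<Rightarrow> nat" where r3: "strict_mono r3"
      "(\<forall>i. ratio (g (r1 (r2 (r3 i)))) = ratio (g (r1 (r2 (r3 0))))) \<or>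
       strict_mono (\<lambda>i. ratio (g (r1 (r2 (r3 i))))) \<or> strict_mono (\<lambda>i. - ratio (g (r1 (r2 (r3 i)))))"
      using subseq_const_or_strict[of "\<lambda>i. ratio (g (r1 (r2 i)))"] by blast
    define r where "r i = r1 (r2 (r3 i))" for i
    have r: "strict_mono r" using r1(1) r2(1) r3(1) by (auto simp: r_def strict_mono_def)
    then have srm: "strict_mono (\<lambda>i. s (r i))" using s(1) by (auto simp: strict_mono_def)
    have f: "(\<forall>i. ratio (f (r i)) = ratio (f (r 0))) \<or>
       strict_mono (\<lambda>i. ratio (f (r i))) \<or> strict_mono (\<lambda>i. - ratio (f (r i)))"
      using r2(2)
    proof (elim disjE)
      assume "\<forall>i. ratio (f (r1 (r2 i))) = ratio (f (r1 (r2 0)))"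
      then show ?thesis unfolding r_def by metis
    qed (use r3(1) in \<open>auto simp: strict_mono_def r_def\<close>)
    have g: "(\<forall>i. ratio (g (r i)) = ratio (g (r 0))) \<or>
       strict_mono (\<lambda>i. ratio (g (r i))) \<or> strict_mono (\<lambda>i. - ratio (g (r i)))"
      using r3(2) unfolding r_def .
    obtain L where L: "(\<lambda>i. ratio (f (r i))) \<longlonglongrightarrow> L" using ratio_seq_convergent[OF f] .
    obtain M where M: "(\<lambda>i. ratio (g (r i))) \<longlonglongrightarrow> M" using ratio_seq_convergent[OF g] .
    have xfg: "x (s (r i)) = ratio (f (r i)) * ratio (g (r i))" for i
      using e'(2)[of "s (r i)"] by (simp add: fg(1) ratio_Mul)
    have l: "l = L * M"
      using LIMSEQ_unique[OF limsub[OF srm]] tendsto_mult[OF L M] unfolding xfg by blast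
    have bnd: "0 \<le> L" "0 \<le> M" "L \<le> 49 / 50" "M \<le> 49 / 50"
      using LIMSEQ_le_const[OF L, of 0] LIMSEQ_le_const[OF M, of 0]
        LIMSEQ_le_const2[OF L, of "49 / 50"] LIMSEQ_le_const2[OF M, of "49 / 50"] fg(2,3)
      by (simp_all add: less_imp_le)
    have "(49 / 50) ^ m * (49 / 50) < L * M" using Suc.prems(4) l by simp
    then have big: "(49 / 50) ^ m < L" "(49 / 50) ^ m < M"
      using mult_left_mono[OF bnd(4) bnd(1)] mult_right_mono[OF bnd(3) bnd(2)] by linarith+
    define b where "b = ones_count (f (r 0))"
    define b' where "b' = ones_count (g (r 0))"
    have bf: "ones_count (f (r i)) mod 3 = b mod 3" for i
      using r1(2)[of "r2 (r3 i)"] r1(2)[of "r2 (r3 0)"] by (simp add: p_def r_def b_def)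
    have bg: "ones_count (g (r i)) mod 3 = b' mod 3" for i
      using r1(2)[of "r2 (r3 i)"] r1(2)[of "r2 (r3 0)"] by (simp add: p_def r_def b'_def)
    have ab: "(b + b') mod 3 = a mod 3"
      using e'(3)[of "s (r 0)"] by (simp add: fg(1) b_def b'_def)
    \<comment> \<open>Stated once for either factor. If not constant, the factor falls under the
      induction hypothesis, which forbids increase and splits \<open>\<kappa>\<close> off its
      limit.\<close>
    have factor: "ratio (h (r 1)) \<le> ratio (h (r 0)) \<and> K \<in> closure (ratios k) \<and>
        ((\<forall>i. ratio (h (r i)) = ratio (h (r 0))) \<or> (\<exists>y\<in>closure (ratios (k + 2)). K = \<kappa> * y))"
      if h: "(\<forall>i. ratio (h (r i)) = ratio (h (r 0))) \<or>
          strict_mono (\<lambda>i. ratio (h (r i))) \<or> strict_mono (\<lambda>i. - ratio (h (r i)))"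
        and K: "(\<lambda>i. ratio (h (r i))) \<longlonglongrightarrow> K" "(49 / 50) ^ m < K"
        and k: "\<And>i. ones_count (h (r i)) mod 3 = k mod 3" for h K k
    proof (cases "\<forall>i. ratio (h (r i)) = ratio (h (r 0))")
      case True
      then show ?thesis using ratio_limit_in_closure[OF k K(1)] by (metis order_refl)
    next
      case False
      with h have h': "strict_mono (\<lambda>i. ratio (h (r i))) \<or> strict_mono (\<lambda>i. - ratio (h (r i)))"
        by blast
      note * = IH[of "\<lambda>i. h (r i)", OF k h' K]
      then have "strict_mono (\<lambda>i. - ratio (h (r i)))" using h' by blast
      then have "- ratio (h (r 0)) < - ratio (h (r 1))" by (rule strict_monoD) simp
      then show ?thesis using * ratio_limit_in_closure[OF k K(1)] by simp
    qed
    note fac_f = factor[OF f L big(1) bf] and fac_g = factor[OF g M big(2) bg]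
    have "x (s (r 1)) \<le> x (s (r 0))"
      unfolding xfg using fac_f fac_g by (intro mult_mono) (auto intro: less_imp_le)
    moreover have "s (r 0) < s (r 1)" by (rule strict_monoD[OF srm]) simp
    ultimately have "\<not> strict_mono x" using strict_monoD[of x] by (metis not_less)
    moreover have "\<exists>y\<in>closure (ratios (a + 2)). l = \<kappa> * y"
    proof -
      \<comment> \<open>At least one factor is not constant, as the products are distinct. The
        \<open>\<kappa>\<close> split off its limit is the one needed for l; the other limit is
        multiplied on.\<close>
      have "\<not> ((\<forall>i. ratio (f (r i)) = ratio (f (r 0))) \<and> (\<forall>i. ratio (g (r i)) = ratio (g (r 0))))"
      proof
        assume *: "(\<forall>i. ratio (f (r i)) = ratio (f (r 0))) \<and> (\<forall>i. ratio (g (r i)) = ratio (g (r 0)))"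
        then have "x (s (r 1)) = x (s (r 0))" unfolding xfg by metis
        then have "s (r 1) = s (r 0)" using inj by (auto dest: injD)
        then show False using strict_mono_eq[OF srm, of 1 0] by simp
      qed
      then consider (F) y where "y \<in> closure (ratios (b + 2))" "L = \<kappa> * y"
        | (G) y where "y \<in> closure (ratios (b' + 2))" "M = \<kappa> * y"
        using fac_f fac_g by blast
      then show ?thesis
      proof cases
        case F
        have "y * M \<in> closure (ratios (b + 2 + b'))"
          using F(1) fac_g by (intro closure_ratios_mult) auto
        moreover have "ratios (b + 2 + b') = ratios (a + 2)"
          using mod_add_cong[OF ab refl, of 2] by (intro ratios_cong) (simp add: ac_simps)
        ultimately show ?thesis using l F(2) by (intro bexI[of _ "y * M"]) auto
      next
        case G
        have "L * y \<in> closure (ratios (b + (b' + 2)))"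
          using G(1) fac_f by (intro closure_ratios_mult) auto
        moreover have "ratios (b + (b' + 2)) = ratios (a + 2)"
          using mod_add_cong[OF ab refl, of 2] by (intro ratios_cong) (simp add: ac_simps)
        ultimately show ?thesis using l G(2) by (intro bexI[of _ "L * y"]) auto
      qed
    qed
    ultimately show ?thesis unfolding x_def by blast
  qed
qed

text \<open>This is the well-foundedness of the defects. An increasing sequence of ratios has a
  positive limit, and on a subsequence with constant residue \<open>ratio_limit_aux\<close> excludes
  it.\<close>

lemma ratio_not_strict_mono:
  fixes e :: "nat \<Rightarrow> expr"
  shows "\<not> strict_mono (\<lambda>i. ratio (e i))"
proof
  assume *: "strict_mono (\<lambda>i. ratio (e i))"
  have "finite (range (\<lambda>i. ones_count (e i) mod 3))"
    by (rule finite_subset[of _ "{..2}"]) auto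
  then obtain s :: "nat \<Rightarrow> nat"
    where s: "strict_mono s" "\<And>i. ones_count (e (s i)) mod 3 = ones_count (e (s 0)) mod 3"
    using subseq_const_of_finite[of "\<lambda>i. ones_count (e i) mod 3"] by blast
  have mono: "strict_mono (\<lambda>i. ratio (e (s i)))"
    using strict_monoD[OF *] strict_monoD[OF s(1)] by (auto intro!: strict_monoI)
  then obtain l where l: "(\<lambda>i. ratio (e (s i))) \<longlonglongrightarrow> l"
    using ratio_seq_convergent[of "\<lambda>i. e (s i)"] by blast
  have "ratio (e (s 0)) \<le> l"
    using strict_mono_leD[OF mono, of 0] by (intro LIMSEQ_le_const[OF l]) auto
  then have "l > 0" using ratio_pos[of "e (s 0)"] by linarith
  then obtain m where "(49 / 50) ^ m < l" using real_arch_pow_inv[of l "49 / 50"] by auto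
  then show False
    using ratio_limit_aux[of "\<lambda>i. e (s i)" "ones_count (e (s 0))" l m, OF s(2) _ l] mono by blast
qed

text \<open>A sequence that avoids its limit l has no subsequence constant in ratio, so some
  subsequence is strictly monotone. The index a + 2 stands for a - 1 modulo 3.\<close>

lemma ratios_islimpt:
  assumes "l islimpt ratios a" "l > 0"
  shows "\<exists>y\<in>closure (ratios (a + 2)). l = \<kappa> * y"
proof -
  obtain x where x: "\<And>n. x n \<in> ratios a - {l}" "x \<longlonglongrightarrow> l"
    using assms(1) unfolding islimpt_sequential by blast
  have "\<exists>e. x n = ratio e \<and> ones_count e mod 3 = a mod 3" for n
    using x(1)[of n] by (auto simp: ratios_def)
  then obtain e where e: "\<And>n. x n = ratio (e n)" "\<And>n. ones_count (e n) mod 3 = a mod 3"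
    by metis
  obtain s :: "nat \<Rightarrow> nat" where s: "strict_mono s" "(\<forall>i. ratio (e (s i)) = ratio (e (s 0))) \<or>
      strict_mono (\<lambda>i. ratio (e (s i))) \<or> strict_mono (\<lambda>i. - ratio (e (s i)))"
    using subseq_const_or_strict[of "\<lambda>i. ratio (e i)"] by blast
  have lim: "(\<lambda>i. ratio (e (s i))) \<longlonglongrightarrow> l"
    using LIMSEQ_subseq_LIMSEQ[OF x(2) s(1)] by (simp add: o_def e(1))
  have "\<not> (\<forall>i. ratio (e (s i)) = ratio (e (s 0)))"
  proof
    assume "\<forall>i. ratio (e (s i)) = ratio (e (s 0))"
    then have "(\<lambda>i. ratio (e (s i))) = (\<lambda>i. x (s 0))" by (auto simp: e(1))
    then have "l = x (s 0)" using lim LIMSEQ_unique[OF _ tendsto_const] by metis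
    then show False using x(1)[of "s 0"] by simp
  qed
  moreover obtain m where "(49 / 50) ^ m < l" using real_arch_pow_inv[of l "49 / 50"] assms(2) by auto
  ultimately show ?thesis
    using ratio_limit_aux[of "\<lambda>i. e (s i)" a l m, OF e(2) _ lim] s(2) by blast
qed

section \<open>Copies of powers of omega\<close>

definition omega_less :: "nat \<Rightarrow> nat list \<Rightarrow> nat list \<Rightarrow> bool" where
  "omega_less k u v \<longleftrightarrow> (u, v) \<in> omega_power k \<and> u \<noteq> v"

lemma omega_less_0 [simp]: "\<not> omega_less 0 u v"
  by (auto simp: omega_less_def)

lemma omega_less_Suc [simp]:
  "omega_less (Suc k) (i # u) (j # v) \<longleftrightarrow>
     length u = k \<and> length v = k \<and> (i < j \<or> i = j \<and> omega_less k u v)"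
  by (auto simp: omega_less_def Field_omega_power)

lemma omega_less_length: "omega_less k u v \<Longrightarrow> length u = k \<and> length v = k"
  by (simp add: omega_less_def omega_power_iff)

text \<open>Each of the consecutive copies of omega^k contributes, by induction, a point of the
  closure for a - k (written a + 2k). These points descend to a limit point, from which
  \<open>ratios_islimpt\<close> splits one more \<open>\<kappa>\<close>.\<close>

lemma omega_power_limit:
  assumes "\<And>u v. omega_less k u v \<Longrightarrow> g v < g u"
    and "\<And>u. length u = k \<Longrightarrow> g u \<in> ratios a"
    and "\<And>u. length u = k \<Longrightarrow> l \<le> g u" "0 < l"
  shows "\<exists>y\<in>closure (ratios (a + 2 * k)). l \<le> \<kappa> ^ k * y \<and> (\<forall>u. length u = k \<longrightarrow> \<kappa> ^ k * y \<le> g u)"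
  using assms
proof (induction k arbitrary: g l)
  case 0
  then show ?case using closure_subset by (intro bexI[of _ "g []"]) auto
next
  case (Suc k)
  (* Consecutive y j, y (Suc j) below need not be distinct, which is why s takes every second one. *)
  define z where "z = replicate k (0 :: nat)"
  have z: "length z = k" by (simp add: z_def)
  have dec: "g (j # v) < g (i # u)" if "i < j" "length u = k" "length v = k" for i j u v
    using Suc.prems(1)[of "i # u" "j # v"] that by simp
  \<comment> \<open>As lower bound for block j the first element of block j + 1 is taken instead of
    l; this separates the resulting points.\<close>
  have "\<exists>y\<in>closure (ratios (a + 2 * k)). g (Suc j # z) \<le> \<kappa> ^ k * y \<and>
      (\<forall>u. length u = k \<longrightarrow> \<kappa> ^ k * y \<le> g (j # u))" for j
  proof (rule Suc.IH)
    show "g (j # v) < g (j # u)" if "omega_less k u v" for u v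
      using Suc.prems(1)[of "j # u" "j # v"] that omega_less_length[OF that] by simp
    show "g (j # u) \<in> ratios a" if "length u = k" for u using Suc.prems(2) that by simp
    show "g (Suc j # z) \<le> g (j # u)" if "length u = k" for u
      using dec[of j "Suc j" u z] that z by simp
    show "0 < g (Suc j # z)" using Suc.prems(3)[of "Suc j # z"] Suc.prems(4) z by simp
  qed
  then obtain y where y: "\<And>j. y j \<in> closure (ratios (a + 2 * k))"
      "\<And>j. g (Suc j # z) \<le> \<kappa> ^ k * y j" "\<And>j u. length u = k \<Longrightarrow> \<kappa> ^ k * y j \<le> g (j # u)"
    by metis
  define s where "s j = y (2 * j)" for j
  have s_less: "s (Suc j) < s j" for j
  proof -
    have "\<kappa> ^ k * s (Suc j) \<le> g (Suc (Suc (2 * j)) # z)" unfolding s_def using y(3)[OF z] by simp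
    also have "\<dots> < g (Suc (2 * j) # z)" using dec z by simp
    also have "\<dots> \<le> \<kappa> ^ k * s j" unfolding s_def by (rule y(2))
    finally show ?thesis by simp
  qed
  have lower: "l / \<kappa> ^ k \<le> s j" for j
  proof -
    have "l \<le> \<kappa> ^ k * y (2 * j)"
      using Suc.prems(3)[of "Suc (2 * j) # z"] y(2)[of "2 * j"] z by simp
    then show ?thesis by (simp add: s_def divide_le_eq mult.commute)
  qed
  have "decseq s" using s_less by (intro decseq_SucI less_imp_le)
  then obtain Y where Y: "s \<longlonglongrightarrow> Y" "\<And>j. Y \<le> s j"
    using decseq_convergent[of s "l / \<kappa> ^ k"] lower by blast
  have "l / \<kappa> ^ k \<le> Y" using lower by (intro LIMSEQ_le_const[OF Y(1)]) auto
  then have lY: "l \<le> \<kappa> ^ k * Y" by (simp add: divide_le_eq mult.commute)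
  then have "Y > 0" using Suc.prems(4) by (metis kappa_pos less_le_trans zero_less_mult_pos zero_less_power)
  have "Y islimpt closure (ratios (a + 2 * k))"
    unfolding islimpt_sequential
  proof (intro exI conjI allI)
    show "s j \<in> closure (ratios (a + 2 * k)) - {Y}" for j
      using y(1)[of "2 * j"] Y(2)[of "Suc j"] s_less[of j] by (simp add: s_def)
  qed (rule Y(1))
  then obtain w where w: "w \<in> closure (ratios (a + 2 * k + 2))" "Y = \<kappa> * w"
    using ratios_islimpt \<open>Y > 0\<close> unfolding limpt_of_closure by blast
  show ?case
  proof (intro bexI conjI allI impI)
    show "w \<in> closure (ratios (a + 2 * Suc k))" using w(1) by (simp add: algebra_simps)
    have *: "\<kappa> ^ Suc k * w = \<kappa> ^ k * Y" by (simp add: w(2))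
    show "l \<le> \<kappa> ^ Suc k * w" unfolding * by (rule lY)
    fix u :: "nat list"
    assume "length u = Suc k"
    then obtain j v where u: "u = j # v" "length v = k" by (cases u) auto
    have "\<kappa> ^ k * Y \<le> \<kappa> ^ k * s (Suc j)" using Y(2) by (intro mult_left_mono) auto
    also have "\<dots> \<le> g (2 * Suc j # v)" unfolding s_def by (rule y(3)[OF u(2)])
    also have "\<dots> \<le> g u" using dec[of j "2 * Suc j" v v] u by simp
    finally show "\<kappa> ^ Suc k * w \<le> g u" unfolding * .
  qed
qed

section \<open>Towers, which realise decreasing copies of omega^k\<close>

definition triple :: "expr \<Rightarrow> expr" where
  "triple e = Mul e (Add One (Add One One))"

lemma triple_pow: "expr_val ((triple ^^ j) e) = 3 ^ j * expr_val e"
  "ones_count ((triple ^^ j) e) = ones_count e + 3 * j"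
  by (induction j) (simp_all add: triple_def)

lemma kappa_power_mult_3: "\<kappa> ^ (3 * j) = (1 / 3) ^ j"
  by (simp add: power_mult kappa_cube)

lemma ratio_triple_pow: "ratio ((triple ^^ j) e) = ratio e"
  by (simp add: ratio_def triple_pow power_add kappa_power_mult_3 power_one_over)

text \<open>For \<open>u = [j\<^sub>1, \<dots>, j\<^sub>k]\<close> the value of \<open>tower e u\<close> is that of the low-defect polynomial
  \<open>(\<dots>(b x\<^sub>1 + 1) x\<^sub>2 + \<dots>) x\<^sub>k + 1\<close>, where \<open>b\<close> is the value of \<open>e\<close>, at the powers
  \<open>x\<^sub>i\<close> of 3 with exponents \<open>j\<^sub>i + 1\<close>.\<close>

primrec tower :: "expr \<Rightarrow> nat list \<Rightarrow> expr" where
  "tower e [] = e"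
| "tower e (j # u) = tower (Add ((triple ^^ Suc j) e) One) u"

lemma ratio_tower_step:
  "ratio (Add ((triple ^^ j) e) One) = \<kappa> * (ratio e + \<kappa> ^ ones_count e * (1 / 3) ^ j)"
  unfolding ratio_Add ratio_triple_pow ratio_One triple_pow power_add kappa_power_mult_3
  by (simp add: algebra_simps)

lemma tower_step_power:
  "\<kappa> ^ ones_count (Add ((triple ^^ j) e) One) = \<kappa> * (\<kappa> ^ ones_count e * (1 / 3) ^ j)"
  by (simp add: triple_pow power_add kappa_power_mult_3 del: power_mult)

lemma ones_count_tower: "ones_count (tower e u) mod 3 = (ones_count e + length u) mod 3"
proof (induction u arbitrary: e)
  case (Cons j u)
  have "ones_count (tower e (j # u)) mod 3 = (ones_count e + length (j # u) + Suc j * 3) mod 3"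
    unfolding tower.simps Cons ones_count.simps triple_pow by (simp add: ac_simps)
  then show ?case by (simp only: mod_mult_self1)
qed simp

lemma expr_val_tower: "expr_val e \<le> expr_val (tower e u)"
proof (induction u arbitrary: e)
  case (Cons j u)
  have "1 * expr_val e \<le> 3 ^ Suc j * expr_val e" by (rule mult_le_mono1) simp
  then have "expr_val e \<le> expr_val (Add ((triple ^^ Suc j) e) One)"
    unfolding expr_val.simps triple_pow by linarith
  also note Cons
  finally show ?case by simp
qed simp

lemma ratio_tower_ge: "\<kappa> ^ length u * ratio e \<le> ratio (tower e u)"
proof (induction u arbitrary: e)
  case (Cons j u)
  have "\<kappa> * ratio e \<le> ratio (Add ((triple ^^ Suc j) e) One)"
    unfolding ratio_tower_step by (intro mult_left_mono) auto
  then have "\<kappa> ^ length u * (\<kappa> * ratio e) \<le> \<kappa> ^ length u * ratio (Add ((triple ^^ Suc j) e) One)"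
    by (intro mult_left_mono) auto
  also note Cons
  finally show ?case by (simp add: mult_ac)
qed simp

text \<open>The 1/2 is the sum of 1/3 + 1/9 + ... . With t = (1/3)^(j+1), one step turns the bracket
  into \<open>\<kappa>\<close> times the ratio plus 3t/2 times the power, and 3t/2 is at most
  1/2.\<close>

lemma ratio_tower_le: "ratio (tower e u) \<le> \<kappa> ^ length u * (ratio e + \<kappa> ^ ones_count e / 2)"
proof (induction u arbitrary: e)
  case (Cons j u)
  let ?e = "Add ((triple ^^ Suc j) e) One"
  have "\<kappa> ^ ones_count e * (1 / 3) ^ Suc j \<le> \<kappa> ^ ones_count e * (1 / 3)"
    using power_decreasing[of 1 "Suc j" "1 / 3 :: real"] by (intro mult_left_mono) auto
  then have "ratio ?e + \<kappa> ^ ones_count ?e / 2 \<le> \<kappa> * (ratio e + \<kappa> ^ ones_count e / 2)"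
    unfolding ratio_tower_step tower_step_power by (simp add: algebra_simps del: power_Suc)
  then have "\<kappa> ^ length u * (ratio ?e + \<kappa> ^ ones_count ?e / 2)
      \<le> \<kappa> ^ length u * (\<kappa> * (ratio e + \<kappa> ^ ones_count e / 2))"
    by (intro mult_left_mono) auto
  with Cons[of ?e] have "ratio (tower ?e u) \<le> \<kappa> ^ length u * (\<kappa> * (ratio e + \<kappa> ^ ones_count e / 2))"
    by (rule order_trans)
  then show ?case by (simp add: mult_ac)
qed simp

lemma ratio_tower_decreasing: "omega_less k u v \<Longrightarrow> ratio (tower e v) < ratio (tower e u)"
proof (induction k arbitrary: u v e)
  case (Suc k)
  obtain i u' j v' where uv: "u = i # u'" "v = j # v'" "length u' = k" "length v' = k"
    using omega_less_length[OF Suc.prems] by (auto simp: length_Suc_conv)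
  consider "i < j" | "i = j" "omega_less k u' v'" using Suc.prems uv by auto
  then show ?case
  proof cases
    case 1
    let ?c = "\<kappa> ^ ones_count e" and ?f = "\<lambda>j. Add ((triple ^^ Suc j) e) One"
    have "(1 / 3) ^ Suc j \<le> (1 / 3 :: real) ^ Suc (Suc i)" using 1 by (intro power_decreasing) auto
    moreover have "(0 :: real) < (1 / 3) ^ i" by simp
    ultimately have "3 / 2 * (1 / 3) ^ Suc j < (1 / 3 :: real) ^ Suc i" unfolding power_Suc by linarith
    then have "\<kappa> * (ratio e + ?c * (3 / 2 * (1 / 3) ^ Suc j)) < \<kappa> * (ratio e + ?c * (1 / 3) ^ Suc i)"
      by (intro mult_strict_left_mono add_strict_left_mono) auto
    then have "\<kappa> ^ k * (ratio (?f j) + \<kappa> ^ ones_count (?f j) / 2) < \<kappa> ^ k * ratio (?f i)"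
      unfolding ratio_tower_step tower_step_power
      by (intro mult_strict_left_mono) (auto simp: algebra_simps)
    then show ?thesis
      using ratio_tower_le[of "?f j" v'] ratio_tower_ge[of u' "?f i"]
      unfolding uv(3,4) unfolding uv(1,2) tower.simps by linarith
  next
    case 2
    then show ?thesis using Suc.IH[OF 2(2)] uv by simp
  qed
qed simp

text \<open>The indecomposability of omega^k. Every block contains a monochromatic copy of the
  smaller power by induction, and infinitely many blocks yield the same colour; \<open>f\<close>
  enumerates such blocks.\<close>

lemma omega_power_colouring:
  "\<exists>h. (\<forall>u. length u = k \<longrightarrow> length (h u) = k) \<and>
     (\<forall>u v. omega_less k u v \<longrightarrow> omega_less k (h u) (h v)) \<and>
     ((\<forall>u. length u = k \<longrightarrow> P (h u)) \<or> (\<forall>u. length u = k \<longrightarrow> \<not> P (h u)))"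
proof (induction k arbitrary: P)
  case 0
  show ?case by (rule exI[of _ id]) auto
next
  case (Suc k)
  obtain H where H: "\<And>j u. length u = k \<Longrightarrow> length (H j u) = k"
      "\<And>j u v. omega_less k u v \<Longrightarrow> omega_less k (H j u) (H j v)"
      "\<And>j. (\<forall>u. length u = k \<longrightarrow> P (j # H j u)) \<or> (\<forall>u. length u = k \<longrightarrow> \<not> P (j # H j u))"
    using Suc[of "\<lambda>u. P (_ # u)"] by metis
  define c where "c j \<longleftrightarrow> (\<forall>u. length u = k \<longrightarrow> P (j # H j u))" for j :: nat
  obtain f :: "nat \<Rightarrow> nat" where f: "strict_mono f" "\<And>i. c (f i) = c (f 0)"
    using subseq_const_of_finite[of c] by auto
  define h where "h u = f (hd u) # H (f (hd u)) (tl u)" for u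
  have "(\<forall>u. length u = Suc k \<longrightarrow> P (h u)) \<or> (\<forall>u. length u = Suc k \<longrightarrow> \<not> P (h u))"
  proof (cases "c (f 0)")
    case True
    then have "c (f i)" for i using f(2) by blast
    then show ?thesis unfolding c_def h_def by simp
  next
    case False
    then have "\<not> c (f i)" for i using f(2) by blast
    then have "\<forall>u. length u = k \<longrightarrow> \<not> P (f i # H (f i) u)" for i using H(3)[of "f i"] unfolding c_def by blast
    then show ?thesis unfolding h_def by simp
  qed
  moreover have "length (h u) = Suc k" if "length u = Suc k" for u using that H(1) by (simp add: h_def)
  moreover have "omega_less (Suc k) (h u) (h v)" if less: "omega_less (Suc k) u v" for u v
  proof -
    obtain i u' j v' where uv: "u = i # u'" "v = j # v'" "length u' = k" "length v' = k"
      using omega_less_length[OF less] by (auto simp: length_Suc_conv)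
    then show ?thesis using less H(1,2) strict_monoD[OF f(1), of i j] by (auto simp: h_def)
  qed
  ultimately show ?case by (intro exI[of _ h]) blast
qed

text \<open>The image of \<open>h\<close> need not be an initial segment. If s were shorter, it
  would be isomorphic to the part of r below some a, and composing with \<open>h\<close> gives a
  strictly monotone self-map of r that moves a down, which a well-order does not allow.\<close>

lemma not_ordLess_of_strict_embedding:
  assumes "Well_order r" and h: "\<And>x. x \<in> Field r \<Longrightarrow> h x \<in> Field s"
    and mono: "\<And>x y. (x, y) \<in> r \<Longrightarrow> x \<noteq> y \<Longrightarrow> (h x, h y) \<in> s \<and> h x \<noteq> h y"
  shows "(s, r) \<notin> ordLess"
proof
  assume less: "(s, r) \<in> ordLess"
  then have "Well_order s" by (auto simp: ordLess_def)
  then obtain a where a: "a \<in> Field r" "(s, Restr r (underS r a)) \<in> ordIso"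
    using less assms(1) ordLess_iff_ordIso_Restr by blast
  then obtain f where f: "iso s (Restr r (underS r a)) f" "Well_order s"
    unfolding ordIso_def by auto
  have bij: "bij_betw f (Field s) (Field (Restr r (underS r a)))" using f(1) by (simp add: iso_def)
  have fa: "f x \<in> underS r a" if "x \<in> Field s" for x
    using bij_betwE[OF bij] that by (auto simp: Field_def)
  have fm: "(f x, f y) \<in> r \<and> f x \<noteq> f y" if "(x, y) \<in> s" "x \<noteq> y" for x y
  proof -
    have "x \<in> Field s" "y \<in> Field s" using that by (auto simp: Field_def)
    then have "f x \<noteq> f y" using bij that(2) by (auto simp: bij_betw_def inj_on_def)
    moreover have "compat s (Restr r (underS r a)) f"
      using f embed_compat by (auto simp: iso_def)
    ultimately show ?thesis using that(1) by (auto simp: compat_def)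
  qed
  define p where "p x = f (h x)" for x
  have pm: "(p x, p y) \<in> r - Id" if "(x, y) \<in> r - Id" for x y
    using fm mono that unfolding p_def by auto
  have "wf (r - Id)" using assms(1) by (simp add: well_order_on_def)
  \<comment> \<open>If p moves x down, it also moves p x down, so there is no least such x.\<close>
  then have "(p x, x) \<notin> r - Id" for x
  proof (induction x rule: wf_induct_rule)
    case (less x)
    show ?case using less[of "p x"] pm[of "p x" x] by blast
  qed
  moreover have "(p a, a) \<in> r - Id" using fa[OF h[OF a(1)]] by (auto simp: p_def underS_def)
  ultimately show False by blast
qed

section \<open>Defects\<close>

definition opt_ratio :: "nat \<Rightarrow> real" where
  "opt_ratio n = real n * \<kappa> ^ complexity n"

lemma opt_ratio_attained:
  assumes "n \<ge> 1"
  obtains e where "expr_val e = n" "ones_count e = complexity n" "ratio e = opt_ratio n"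
  using complexity_attained[OF assms] by (auto simp: opt_ratio_def ratio_def)

lemma opt_ratio_pos: "n \<ge> 1 \<Longrightarrow> 0 < opt_ratio n"
  by (simp add: opt_ratio_def)

lemma defect_eq_log:
  assumes "n \<ge> 1"
  shows "defect n = - 3 * log 3 (opt_ratio n)"
proof -
  have "log 3 (\<kappa> ^ 3) = -1" unfolding kappa_cube by (simp add: log_divide)
  then have "3 * log 3 \<kappa> = -1" by (simp add: log_nat_power)
  moreover have "log 3 (opt_ratio n) = log 3 (real n) + complexity n * log 3 \<kappa>"
    using assms by (simp add: opt_ratio_def log_mult log_nat_power)
  ultimately show ?thesis by (simp add: defect_def algebra_simps)
qed

lemma defect_less_iff:
  assumes "m \<ge> 1" "n \<ge> 1"
  shows "defect m < defect n \<longleftrightarrow> opt_ratio n < opt_ratio m"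
  using assms by (simp add: defect_eq_log opt_ratio_pos)

lemma defect_nonneg:
  assumes "n \<ge> 1"
  shows "0 \<le> defect n"
proof -
  obtain e where "ratio e = opt_ratio n" using opt_ratio_attained[OF assms] .
  then have "opt_ratio n \<le> 1" using ratio_le_1[of e] by simp
  then show ?thesis using assms by (simp add: defect_eq_log opt_ratio_pos)
qed

definition defects_below :: "nat \<Rightarrow> real set" where
  "defects_below n = defects_mod3 (complexity n) \<inter> {0..<defect n}"

lemma defects_below_iff:
  assumes "n > 1"
  shows "x \<in> defects_below n \<longleftrightarrow> (\<exists>m>1. x = defect m \<and> complexity m mod 3 = complexity n mod 3 \<and>
    opt_ratio n < opt_ratio m)"
proof -
  have "m \<ge> 1 \<and> m \<noteq> 1 \<longleftrightarrow> m > 1" for m :: nat by linarith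
  then show ?thesis
    using assms defect_nonneg defect_less_iff[of _ n]
    by (auto simp: defects_below_def defects_mod3_def less_imp_le)
qed

lemma Field_relation_of_le: "Field (relation_of (\<le>) (S :: 'a :: order set)) = S"
  by (auto simp: Field_def relation_of_def)

lemma Well_order_defects_below:
  assumes "n > 1"
  shows "Well_order (relation_of (\<le>) (defects_below n))" (is "Well_order ?r")
proof -
  have "wf (?r - Id)"
    unfolding wf_iff_no_infinite_down_chain
  proof
    assume "\<exists>f. \<forall>i. (f (Suc i), f i) \<in> ?r - Id"
    then obtain f where f': "\<And>i. (f (Suc i), f i) \<in> ?r - Id" by blast
    have f: "f (Suc i) < f i" "f i \<in> defects_below n" for i
      using f'[of i] by (auto simp: relation_of_def)
    obtain m where m: "\<And>i. m i > 1" "\<And>i. f i = defect (m i)"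
      using f(2) unfolding defects_below_iff[OF assms] by metis
    have "\<exists>e. ratio e = opt_ratio (m i)" for i
      using opt_ratio_attained[of "m i"] m(1)[of i] by (metis less_imp_le)
    then obtain e where e: "\<And>i. ratio (e i) = opt_ratio (m i)" by metis
    have "ratio (e i) < ratio (e (Suc i))" for i
      using f(1)[of i] defect_less_iff[of "m (Suc i)" "m i"] m(1)[of i] m(1)[of "Suc i"]
      by (simp add: e m(2))
    then show False using ratio_not_strict_mono[of e] by (simp add: strict_mono_Suc_iff)
  qed
  then show ?thesis
    unfolding well_order_on_def linear_order_on_def partial_order_on_def preorder_on_def
      Field_relation_of_le
    by (auto simp: relation_of_def refl_on_def trans_def antisym_def total_on_def)
qed

section \<open>Bounds for the order type in terms of E\<close>

lemma cpx_E_expr: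
  assumes "m \<ge> 1"
  obtains e where "expr_val e = cpx_E m" "ones_count e = m" "ratio e = real (cpx_E m) * \<kappa> ^ m"
proof -
  obtain e where "expr_val e = cpx_E m" "ones_count e = m"
    using expr_with_cost cpx_E_attained[OF assms] by blast
  then show ?thesis using that by (simp add: ratio_def)
qed

text \<open>A copy of omega^k in the smaller defects consists of ratios above that of n, so
  \<open>omega_power_limit\<close> gives y in the closure for m with n * \<open>\<kappa> ^ m\<close>
  at most y. Comparison with the maximal ratio leaves only n = E(m), where nothing lies
  above.\<close>

lemma ordLess_omega_power_if:
  assumes "n > 1" "m \<ge> 1" "cpx_E m \<le> n" "complexity n = m + k"
  shows "(relation_of (\<le>) (defects_below n), omega_power k) \<in> ordLess"
proof (rule ccontr)
  let ?r = "relation_of (\<le>) (defects_below n)"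
  assume "(?r, omega_power k) \<notin> ordLess"
  then have "(omega_power k, ?r) \<in> ordLeq"
    using ordLess_or_ordLeq[OF Well_order_defects_below[OF assms(1)] Well_order_omega_power] by blast
  then obtain f where f: "embed (omega_power k) ?r f" by (auto simp: ordLeq_def)
  have f_mem: "f u \<in> defects_below n" if "length u = k" for u
    using embed_Field[OF f] that by (auto simp: Field_omega_power Field_relation_of_le)
  have "inj_on f (Field (omega_power k))" by (rule embed_inj_on[OF Well_order_omega_power f])
  then have f_less: "f u < f v" if "omega_less k u v" for u v
    using that omega_less_length[OF that] embed_compat[OF f]
    by (fastforce simp: omega_less_def compat_def relation_of_def inj_on_def Field_omega_power less_le)
  have "\<exists>p. length u = k \<longrightarrow> p > 1 \<and> f u = defect p \<and> complexity p mod 3 = complexity n mod 3 \<and>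
      opt_ratio n < opt_ratio p" for u
    using f_mem[of u] unfolding defects_below_iff[OF assms(1)] by blast
  then obtain p where p: "\<And>u. length u = k \<Longrightarrow> p u > 1" "\<And>u. length u = k \<Longrightarrow> f u = defect (p u)"
      "\<And>u. length u = k \<Longrightarrow> complexity (p u) mod 3 = complexity n mod 3"
      "\<And>u. length u = k \<Longrightarrow> opt_ratio n < opt_ratio (p u)"
    by metis
  have in_ratios: "opt_ratio (p u) \<in> ratios (m + k)" if u: "length u = k" for u
  proof -
    obtain e where "ones_count e = complexity (p u)" "ratio e = opt_ratio (p u)"
      using opt_ratio_attained[of "p u"] p(1)[OF u] by (metis less_imp_le)
    then show ?thesis using ratio_in_ratios[of e "m + k"] p(3)[OF u] assms(4) by simp
  qed
  have "\<exists>y\<in>closure (ratios (m + k + 2 * k)). opt_ratio n \<le> \<kappa> ^ k * y \<and>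
      (\<forall>u. length u = k \<longrightarrow> \<kappa> ^ k * y \<le> opt_ratio (p u))"
  proof (rule omega_power_limit)
    show "opt_ratio (p v) < opt_ratio (p u)" if "omega_less k u v" for u v
      using f_less[OF that] omega_less_length[OF that] p(1,2) defect_less_iff[of "p u" "p v"]
      by (simp add: less_imp_le)
  qed (use in_ratios p(4) opt_ratio_pos assms(1) in \<open>auto intro: less_imp_le\<close>)
  moreover have "ratios (m + k + 2 * k) = ratios m" by (rule ratios_cong, rule sym, rule mod_3_shift) simp
  ultimately obtain y where y: "y \<in> closure (ratios m)" "opt_ratio n \<le> \<kappa> ^ k * y"
    by auto
  have "real n * \<kappa> ^ m * \<kappa> ^ k \<le> y * \<kappa> ^ k"
    using y(2) by (simp add: opt_ratio_def assms(4) power_add mult_ac)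
  then have ny: "real n * \<kappa> ^ m \<le> y" by simp
  show False
  proof (cases "m = 1")
    case True
    have "1 < real n * \<kappa>"
    proof -
      have "2 \<le> real n" using assms(1) by simp
      then show ?thesis using mult_strict_left_mono[OF kappa_gt, of "real n"] by linarith
    qed
    then show False using ny closure_ratios_le(1)[OF y(1)] True by simp
  next
    case False
    then have m: "m \<ge> 2" using assms(2) by simp
    have "real n * \<kappa> ^ m \<le> real (cpx_E m) * \<kappa> ^ m"
      using ny closure_ratios_le(2)[OF y(1) m] by linarith
    then have "n = cpx_E m" using assms(3) by simp
    \<comment> \<open>So k = 0, and the one point of omega^0 would be a ratio above the maximum of
      its class.\<close>
    then have "complexity n \<le> m" using cpx_E_attained[OF assms(2)] by simp
    then have k: "k = 0" using assms(4) by simp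
    have "opt_ratio (p []) \<in> closure (ratios m)"
      using in_ratios[of "[]"] closure_subset k by auto
    then have "opt_ratio (p []) \<le> opt_ratio n"
      using closure_ratios_le(2)[OF _ m] \<open>n = cpx_E m\<close> assms(4) k by (simp add: opt_ratio_def)
    then show False using p(4)[of "[]"] k by simp
  qed
qed

text \<open>Towers over an expression for E(m) of cost m have ratio at least E(m) *
  \<open>\<kappa> ^ (m + k)\<close>, which exceeds the ratio of n, and their cost has the residue of
  m + k. The colouring lemma leaves a copy of omega^k on which the tower's cost is the true
  complexity.\<close>

lemma not_ordLess_omega_power_if:
  assumes "n > 1" "m \<ge> 1" "n < cpx_E m" "complexity n = m + k"
  shows "(relation_of (\<le>) (defects_below n), omega_power k) \<notin> ordLess"
proof -
  have m: "m \<ge> 2"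
  proof (rule ccontr)
    assume "\<not> ?thesis"
    then have "m = 1" using assms(2) by simp
    then show False using assms(1,3) cpx_E_1 by simp
  qed
  obtain b where b: "expr_val b = cpx_E m" "ones_count b = m" "ratio b = real (cpx_E m) * \<kappa> ^ m"
    using cpx_E_expr[OF assms(2)] .
  have b_gt: "\<kappa> < ratio b"
  proof -
    have "max_ratio m \<le> ratio b"
      unfolding b(3) max_ratio_def using cpx_E_ge_max_val[OF assms(2)] by simp
    then show ?thesis using max_ratio_range(1)[OF m] by linarith
  qed
  define t where "t = tower b"
  have t_ge: "\<kappa> ^ k * ratio b \<le> ratio (t u)" if "length u = k" for u
    using ratio_tower_ge[of u b] that by (simp add: t_def)
  define optimal where "optimal u \<longleftrightarrow> complexity (expr_val (t u)) = ones_count (t u)" for u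
  obtain h where h: "\<And>u. length u = k \<Longrightarrow> length (h u) = k"
      "\<And>u v. omega_less k u v \<Longrightarrow> omega_less k (h u) (h v)"
      "(\<forall>u. length u = k \<longrightarrow> optimal (h u)) \<or> (\<forall>u. length u = k \<longrightarrow> \<not> optimal (h u))"
    using omega_power_colouring[of k optimal] by blast
  (* The ratio of a non-optimal expression divided by kappa is again a ratio, and these would
     accumulate at kappa^k times a number larger than 1. *)
  have "\<exists>u. length u = k \<and> optimal (h u)"
  proof (rule ccontr)
    assume "\<not> ?thesis"
    then have bad: "\<not> optimal (h u)" if "length u = k" for u using that by blast
    \<comment> \<open>The index m + k + 2 is the residue after saving one unit of cost.\<close>
    have "\<exists>y\<in>closure (ratios (m + k + 2 + 2 * k)). \<kappa> ^ k * ratio b / \<kappa> \<le> \<kappa> ^ k * y \<and>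
        (\<forall>u. length u = k \<longrightarrow> \<kappa> ^ k * y \<le> ratio (t (h u)) / \<kappa>)"
    proof (rule omega_power_limit)
      show "ratio (t (h v)) / \<kappa> < ratio (t (h u)) / \<kappa>" if "omega_less k u v" for u v
        using ratio_tower_decreasing[OF h(2)[OF that]] by (simp add: t_def divide_strict_right_mono)
      show "ratio (t (h u)) / \<kappa> \<in> ratios (m + k + 2)" if u: "length u = k" for u
      proof -
        let ?c = "ones_count (t (h u))"
        have "complexity (expr_val (t (h u))) < ?c"
          using bad[OF u] complexity_expr_val_le[of "t (h u)"] by (simp add: optimal_def)
        then obtain c where c: "?c = Suc c" "complexity (expr_val (t (h u))) \<le> c"
          by (cases ?c) auto
        then obtain e where e: "expr_val e = expr_val (t (h u))" "ones_count e = c"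
          using expr_with_cost[OF expr_val_pos] by metis
        have "ratio (t (h u)) = \<kappa> * ratio e"
          by (simp add: ratio_def e c(1))
        moreover have "(c + 1) mod 3 = (m + k) mod 3"
          using ones_count_tower[of b "h u"] h(1)[OF u] c(1) by (simp add: t_def b(2))
        then have "ones_count e mod 3 = (m + k + 2) mod 3"
          unfolding e(2) using mod_3_shift[of c 1 "m + k"] by simp
        ultimately show ?thesis using ratio_in_ratios[of e "m + k + 2"] by simp
      qed
      show "\<kappa> ^ k * ratio b / \<kappa> \<le> ratio (t (h u)) / \<kappa>" if "length u = k" for u
        using t_ge[OF h(1)[OF that]] by (intro divide_right_mono) auto
    qed auto
    then obtain y where y: "y \<in> closure (ratios (m + k + 2 + 2 * k))"
        "\<kappa> ^ k * (ratio b / \<kappa>) \<le> \<kappa> ^ k * y"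
      by auto
    have "0 < \<kappa> ^ k" by simp
    then have "ratio b / \<kappa> \<le> y" using y(2) mult_left_le_imp_le by blast
    then have "ratio b / \<kappa> \<le> 1" using closure_ratios_le(1)[OF y(1)] by linarith
    then show False using b_gt by (simp add: divide_le_eq)
  qed
  with h(3) have good: "optimal (h u)" if "length u = k" for u using that by blast
  define d where "d u = defect (expr_val (t (h u)))" for u
  have opt: "opt_ratio (expr_val (t (h u))) = ratio (t (h u))" if "length u = k" for u
    using good[OF that] by (simp add: optimal_def opt_ratio_def ratio_def)
  have d_mem: "d u \<in> defects_below n" if u: "length u = k" for u
    unfolding defects_below_iff[OF assms(1)] d_def
  proof (intro exI conjI)
    show "1 < expr_val (t (h u))"
      using expr_val_tower[of b "h u"] assms(1,3) by (simp add: t_def b(1))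
    have "complexity (expr_val (t (h u))) = ones_count (t (h u))"
      using good[OF u] by (simp add: optimal_def)
    then show "complexity (expr_val (t (h u))) mod 3 = complexity n mod 3"
      using ones_count_tower[of b "h u"] h(1)[OF u] by (simp add: t_def b(2) assms(4))
    have "opt_ratio n < \<kappa> ^ k * ratio b"
      using assms(3) by (simp add: opt_ratio_def assms(4) b(3) power_add mult_ac)
    then show "opt_ratio n < opt_ratio (expr_val (t (h u)))"
      using t_ge[OF h(1)[OF u]] opt[OF u] by linarith
  qed (rule refl)
  have d_less: "d u < d v" if "omega_less k u v" for u v
  proof -
    have "ratio (t (h v)) < ratio (t (h u))"
      using ratio_tower_decreasing[OF h(2)[OF that]] by (simp add: t_def)
    then show ?thesis
      using defect_less_iff[OF expr_val_pos expr_val_pos] opt omega_less_length[OF that]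
      by (simp add: d_def)
  qed
  show ?thesis
  proof (rule not_ordLess_of_strict_embedding[OF Well_order_omega_power, where h = d])
    show "d u \<in> Field (relation_of (\<le>) (defects_below n))" if "u \<in> Field (omega_power k)" for u
      using that d_mem by (simp add: Field_relation_of_le Field_omega_power)
    show "(d u, d v) \<in> relation_of (\<le>) (defects_below n) \<and> d u \<noteq> d v"
      if "(u, v) \<in> omega_power k" "u \<noteq> v" for u v
      using d_less[of u v] d_mem[of u] d_mem[of v] omega_less_length[of k u v] that
      by (simp add: omega_less_def relation_of_def)
  qed
qed

text \<open>Otherwise n + 1, written with one more 1 than n, would have complexity at most L(n) and
  so be at most E(L(n)), hence at most n. Thus the truncated difference in the final proof equals
  the integer defect.\<close>

lemma cpx_L_le_complexity:
  assumes "n \<ge> 1"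
  shows "cpx_L n \<le> complexity n"
proof (rule ccontr)
  assume "\<not> ?thesis"
  then have less: "complexity n < cpx_L n" by simp
  obtain e where e: "expr_val e = n" "ones_count e = complexity n"
    using complexity_attained[OF assms] by blast
  have "complexity (n + 1) \<le> complexity n + 1"
    using complexity_expr_val_le[of "Add e One"] e by simp
  then have "n + 1 \<le> cpx_E (cpx_L n)" using less by (intro le_cpx_E) auto
  then show False using cpx_L_attained[OF assms] by simp
qed

theorem theorem1p8:
  fixes n :: nat
  assumes "n > 1"
  shows "let \<zeta> = relation_of (\<le>) (defects_mod3 (complexity n) \<inter> {0..<defect n}) in
           (\<exists>k. (\<zeta>, omega_power k) \<in> ordLess) \<and>
           integer_defect n = int (LEAST k. (\<zeta>, omega_power k) \<in> ordLess)"
proof -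
  let ?less = "\<lambda>k. (relation_of (\<le>) (defects_below n), omega_power k) \<in> ordLess"
  define d where "d = complexity n - cpx_L n"
  have L: "cpx_L n \<ge> 1" "cpx_E (cpx_L n) \<le> n" "cpx_L n \<le> complexity n"
    using cpx_L_attained[of n] cpx_L_le_complexity[of n] assms by simp_all
  have d: "?less d"
    using assms L by (intro ordLess_omega_power_if[of n "cpx_L n"]) (auto simp: d_def)
  \<comment> \<open>For such k the number m = \<open>complexity n - k\<close> exceeds L(n), so E(m)
    > n by the maximality of L(n).\<close>
  have "\<not> ?less k" if "k < d" for k
  proof (rule not_ordLess_omega_power_if[OF assms])
    show "1 \<le> complexity n - k" "complexity n = complexity n - k + k"
      using that by (simp_all add: d_def)
    then show "n < cpx_E (complexity n - k)"
      using le_cpx_L[of "complexity n - k" n] that L(3) by (force simp: d_def)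
  qed
  then have "(LEAST k. ?less k) = d"
    using d by (intro Least_equality) (auto simp: not_less[symmetric])
  moreover have "integer_defect n = int d"
    using L(3) by (simp add: integer_defect_def d_def of_nat_diff)
  ultimately show ?thesis using d unfolding Let_def defects_below_def[symmetric] by auto
qed

end
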